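(* $(\mathcal{D},\Box)$ is a metric space; that is, the box distance $\Box$ is well defined on isomorphism classes of geometric data sets and is a metric on $\mathcal{D}$.
   Context: A geometric data set is a triple $X=(X,F_X,\mu_X)$ where $X$ is a non-empty set, $F_X$ is a non-empty set of functions $X\to\mathbb{R}$ such that $d_X(x,y):=\sup_{f\in F_X}|f(x)-f(y)|$ is finite for all $x,y\in X$ and is a complete separable metric on $X$, and $\mu_X$ is a Borel probability measure on $(X,d_X)$ with $\operatorname{supp}\mu_X=X$. $\mathrm{Lip}_1(X)$ denotes the set of 1-Lipschitz functions $(X,d_X)\to\mathbb{R}$; one has $F_X\subset \mathrm{Lip}_1(X)$, and $\overline{F_X}$ is the closure of $F_X$ in $\mathrm{Lip}_1(X)$ for pointwise convergence. For a family $F$ of functions and a map $\varphi$, $F\circ\varphi:=\{f\circ\varphi\mid f\in F\}$. Two geometric data sets $X,Y$ are isomorphic if there is a Borel measurable map $\varphi\colon X\to Y$ with $\varphi_*\mu_X=\mu_Y$ and $\overline{F_Y}\circ\varphi=\overline{F_X}$. $\mathcal{D}$ is the set of isomorphism classes of geometric data sets. $\Pi(\mu_X,\mu_Y)$ is the set of couplings: Borel probability measures $\pi$ on $X\times Y$ with marginals $\mu_X$ and $\mu_Y$. $\mathrm{pr}_1,\mathrm{pr}_2$ are the projections of $X\times Y$. For $S\subset X\times Y$, $d^S_\infty(f,g):=\sup_{s\in S}|f(s)-g(s)|$ (with $d^\emptyset_\infty\equiv0$), and $(d^S_\infty)_{\mathrm{H}}$ is the associated ($[0,+\infty]$-valued)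 Hausdorff distance between sets of functions on $X\times Y$. The box distance between geometric data sets is $$\Box(X,Y):=\inf_{\pi,S}\max\{1-\pi(S),\ 2(d^S_\infty)_{\mathrm{H}}(F_X\circ\mathrm{pr}_1,F_Y\circ\mathrm{pr}_2)\},$$ where $\pi$ runs over $\Pi(\mu_X,\mu_Y)$ and $S$ over all closed subsets of $X\times Y$. *)

theory Defs
  imports "HOL-Probability.Probability"
begin

definition borel_sets :: "'a topology \<Rightarrow> 'a set set" where
  "borel_sets T = sigma_sets (topspace T) {U. openin T U}"

definition topological_support :: "'a topology \<Rightarrow> 'a measure \<Rightarrow> 'a set" where
  "topological_support T \<mu> =
     {x \<in> topspace T. \<forall>U. openin T U \<and> x \<in> U \<longrightarrow> emeasure \<mu> U > 0}"

(* A real function on a set X of points is an element of extensional X, so that equality of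
   such functions is equality on X. *)
record 'a data_set =
  points :: "'a set"
  features :: "('a \<Rightarrow> real) set"
  law :: "'a measure"

(* The value 0 off the carrier is only a convention: the locale Metric_space wants
   nonnegativity and symmetry on the whole type. *)
definition feature_dist :: "'a data_set \<Rightarrow> 'a \<Rightarrow> 'a \<Rightarrow> real" where
  "feature_dist X x y =
     (if x \<in> points X \<and> y \<in> points X then SUP f\<in>features X. \<bar>f x - f y\<bar> else 0)"

definition data_topology :: "'a data_set \<Rightarrow> 'a topology" where
  "data_topology X = Metric_space.mtopology (points X) (feature_dist X)"

(* The bdd_above clause is the finiteness of the supremum defining feature_dist. *)
definition geometric_data_set :: "'a data_set \<Rightarrow> bool" where
  "geometric_data_set X \<longleftrightarrow>
     points X \<noteq> {} \<and>
     features X \<noteq> {} \<and> features X \<subseteq> extensional (points X) \<and>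
     (\<forall>x\<in>points X. \<forall>y\<in>points X. bdd_above ((\<lambda>f. \<bar>f x - f y\<bar>) ` features X)) \<and>
     Metric_space (points X) (feature_dist X) \<and>
     Metric_space.mcomplete (points X) (feature_dist X) \<and>
     separable_space (data_topology X) \<and>
     prob_space (law X) \<and>
     sets (law X) = borel_sets (data_topology X) \<and>
     topological_support (data_topology X) (law X) = points X"

definition Lip1 :: "'a data_set \<Rightarrow> ('a \<Rightarrow> real) set" where
  "Lip1 X = {f \<in> extensional (points X).
     \<forall>x\<in>points X. \<forall>y\<in>points X. \<bar>f x - f y\<bar> \<le> feature_dist X x y}"

definition features_closure :: "'a data_set \<Rightarrow> ('a \<Rightarrow> real) set" where
  "features_closure X =
     subtopology (product_topology (\<lambda>_. euclideanreal) (points X)) (Lip1 X)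
       closure_of features X"

definition isomorphic_data_sets :: "'a data_set \<Rightarrow> 'b data_set \<Rightarrow> bool" where
  "isomorphic_data_sets X Y \<longleftrightarrow>
     (\<exists>\<phi> \<in> measurable (law X) (law Y).
        distr (law X) (law Y) \<phi> = law Y \<and>
        (\<lambda>f. compose (points X) f \<phi>) ` features_closure Y = features_closure X)"

definition couplings :: "'a data_set \<Rightarrow> 'b data_set \<Rightarrow> ('a \<times> 'b) measure set" where
  "couplings X Y = {\<pi>. prob_space \<pi> \<and>
     sets \<pi> = borel_sets (prod_topology (data_topology X) (data_topology Y)) \<and>
     distr \<pi> (law X) fst = law X \<and> distr \<pi> (law Y) snd = law Y}"

definition sup_dist_on :: "'a set \<Rightarrow> ('a \<Rightarrow> real) \<Rightarrow> ('a \<Rightarrow> real) \<Rightarrow> ennreal" where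
  "sup_dist_on S f g = (SUP s\<in>S. ennreal \<bar>f s - g s\<bar>)"

definition hausdorff_distance :: "('a \<Rightarrow> 'a \<Rightarrow> ennreal) \<Rightarrow> 'a set \<Rightarrow> 'a set \<Rightarrow> ennreal" where
  "hausdorff_distance d A B =
     max (SUP a\<in>A. INF b\<in>B. d a b) (SUP b\<in>B. INF a\<in>A. d a b)"

definition box_distance :: "'a data_set \<Rightarrow> 'b data_set \<Rightarrow> ennreal" where
  "box_distance X Y =
     (INF \<pi>\<in>couplings X Y.
      INF S\<in>{S. closedin (prod_topology (data_topology X) (data_topology Y)) S}.
        max (1 - emeasure \<pi> S)
            (2 * hausdorff_distance (sup_dist_on S)
               ((\<lambda>f. f \<circ> fst) ` features X) ((\<lambda>g. g \<circ> snd) ` features Y)))"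

definition data_iso_rel :: "('a data_set \<times> 'a data_set) set" where
  "data_iso_rel = {(X, Y). geometric_data_set X \<and> geometric_data_set Y \<and> isomorphic_data_sets X Y}"

(* The underlying sets are the subsets of the type 'a. A complete separable metric space has at
   most continuum many points, so as soon as 'a has at least the cardinality of the continuum
   (for example 'a = real) every geometric data set has a representative here. *)
definition data_set_classes :: "'a data_set set set" where
  "data_set_classes = {X. geometric_data_set X} // data_iso_rel"

(* the_elem picks the common value of box_distance on representatives; it is meaningful because
   box_distance respects data_iso_rel. Off data_set_classes the value 0 is a convention as in
   feature_dist. *)
definition class_box_distance :: "'a data_set set \<Rightarrow> 'a data_set set \<Rightarrow> real" where
  "class_box_distance C D =
     (if C \<in> data_set_classes \<and> D \<in> data_set_classes
      then enn2real (the_elem (\<Union>X\<in>C. \<Union>Y\<in>D. {box_distance X Y})) else 0)"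

end

theory Submission
  imports Defs "HOL-Library.Diagonal_Subsequence"
begin

text \<open>For the triangle inequality two couplings over \<open>Y\<close> are glued conditionally independently
  along a countable partition of \<open>Y\<close> into cells of small diameter. Features are 1-Lipschitz, so
  this costs only the diameter of the cells, and no disintegration of measures is needed.

  If the box distance vanishes, there are couplings whose mass concentrates on closed sets \<open>S n\<close> on
  which the feature families, hence also the metrics, almost agree. Partners in \<open>Y\<close> of a fixed point
  of \<open>X\<close> have small balls around them of mass bounded below, so they form a totally bounded set.
  A diagonal subsequence over a dense sequence of \<open>X\<close> then yields an isometry \<open>X \<rightarrow> Y\<close>, which
  matches the features pointwise and transports the measure because the couplings concentrate near
  its graph. No compactness of the space of couplings is used.\<close>

subsection \<open>Borel sets of second countable spaces and gluing over a countable label\<close>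

text \<open>Several mismatches shape the proof. Couplings are measures on the Borel sets of the
  product topology, whereas gluing and image measures produce product sigma-algebras; separability
  reconciles the two. The infima in the box distance need not be attained and an isomorphism only
  relates closures of feature families, so comparisons are made with real tolerances, through a
  closeness of features along a relation that can be reversed, composed and displaced slightly. One
  constant \<open>c\<close> governs this closeness, and thanks to the factor 2 in the box distance,
  \<open>2 * c\<close> bounds both the lost mass and the distortion of the metrics. Finally, an
  isomorphism is only a measurable map, with no inverse in its definition. Testing features on
  finite sets makes the notion symmetric: two points already force an isometry, and completeness
  together with full support forces surjectivity.\<close>

lemma space_eq_topspace:
  assumes "sets M = borel_sets T"
  shows "space M = topspace T"
proof -
  have "{U. openin T U} \<subseteq> Pow (topspace T)"
    by (auto dest: openin_subset)
  then have "sets M = sets (sigma (topspace T) {U. openin T U})"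
    by (simp add: assms borel_sets_def)
  then show ?thesis
    by (metis sets_eq_imp_space_eq space_measure_of_conv)
qed

lemma openin_sets: "sets M = borel_sets T \<Longrightarrow> openin T U \<Longrightarrow> U \<in> sets M"
  by (auto simp: borel_sets_def)

lemma closedin_sets:
  assumes "sets M = borel_sets T" "closedin T C"
  shows "C \<in> sets M"
proof -
  have "topspace T - C \<in> sets M"
    using assms by (auto intro: openin_sets)
  then have "space M - (topspace T - C) \<in> sets M"
    by auto
  then show ?thesis
    using assms closedin_subset by (metis double_diff order_refl space_eq_topspace)
qed

lemma measurable_continuous_map:
  assumes "sets M = borel_sets T" "sets N = borel_sets U" "continuous_map T U f"
  shows "f \<in> measurable M N"
proof (rule measurable_sigma_sets)
  show "sets N = sigma_sets (topspace U) {V. openin U V}"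
    using assms by (simp add: borel_sets_def)
  show "{V. openin U V} \<subseteq> Pow (topspace U)"
    by (auto dest: openin_subset)
  show "f \<in> space M \<rightarrow> topspace U"
    using assms by (auto simp: space_eq_topspace continuous_map_def)
  show "f -` V \<inter> space M \<in> sets M" if "V \<in> {V. openin U V}" for V
  proof -
    have "openin T {x \<in> topspace T. f x \<in> V}"
      using assms(3) that by (auto simp: continuous_map_def)
    then have "{x \<in> topspace T. f x \<in> V} \<in> sets M"
      using assms(1) openin_sets by blast
    then show ?thesis
      using assms(1) by (simp add: space_eq_topspace vimage_def Int_def conj_commute)
  qed
qed

text \<open>Continuity of the projections gives one inclusion. For the other, countable bases write
  every open set of the product as a countable union of measurable rectangles. Couplings are defined
  on the Borel side and constructed on the product side.\<close>

lemma sets_pair_eq_borel_sets: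
  assumes T: "second_countable T" and U: "second_countable U"
    and M: "sets M = borel_sets T" and N: "sets N = borel_sets U"
  shows "sets (M \<Otimes>\<^sub>M N) = borel_sets (prod_topology T U)"
proof (rule antisym)
  define P where "P = sigma (topspace (prod_topology T U)) {W. openin (prod_topology T U) W}"
  have P: "sets P = borel_sets (prod_topology T U)"
    unfolding P_def borel_sets_def
    by (rule sets_measure_of) (auto dest!: openin_subset)
  have "fst \<in> measurable P M" "snd \<in> measurable P N"
    using measurable_continuous_map[OF P M continuous_map_fst]
      measurable_continuous_map[OF P N continuous_map_snd] by auto
  then have "(\<lambda>z. (fst z, snd z)) \<in> measurable P (M \<Otimes>\<^sub>M N)"
    by (rule measurable_Pair)
  then have id: "(\<lambda>z. z) \<in> measurable P (M \<Otimes>\<^sub>M N)"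
    by simp
  have sp: "space P = space (M \<Otimes>\<^sub>M N)"
    using P M N by (simp add: space_eq_topspace space_pair_measure)
  show "sets (M \<Otimes>\<^sub>M N) \<subseteq> borel_sets (prod_topology T U)"
  proof
    fix A assume A: "A \<in> sets (M \<Otimes>\<^sub>M N)"
    have "A \<inter> space P \<in> sets P"
      using measurable_sets[OF id A] by (simp add: vimage_def)
    then show "A \<in> borel_sets (prod_topology T U)"
      using A sp P sets.sets_into_space[OF A] by (simp add: Int_absorb2)
  qed
  obtain \<B> where \<B>: "countable \<B>" "\<And>V. V \<in> \<B> \<Longrightarrow> openin T V"
      "\<And>W x. openin T W \<Longrightarrow> x \<in> W \<Longrightarrow> \<exists>V\<in>\<B>. x \<in> V \<and> V \<subseteq> W"
    using T unfolding second_countable_def by metis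
  obtain \<C> where \<C>: "countable \<C>" "\<And>V. V \<in> \<C> \<Longrightarrow> openin U V"
      "\<And>W x. openin U W \<Longrightarrow> x \<in> W \<Longrightarrow> \<exists>V\<in>\<C>. x \<in> V \<and> V \<subseteq> W"
    using U unfolding second_countable_def by metis
  have "W \<in> sets (M \<Otimes>\<^sub>M N)" if W: "openin (prod_topology T U) W" for W
  proof -
    let ?I = "{(V, V'). V \<in> \<B> \<and> V' \<in> \<C> \<and> V \<times> V' \<subseteq> W}"
    have W_eq: "W = (\<Union>(V, V')\<in>?I. V \<times> V')"
    proof (intro equalityI subsetI)
      fix z assume "z \<in> W"
      then obtain A B where AB: "openin T A" "openin U B" "fst z \<in> A" "snd z \<in> B" "A \<times> B \<subseteq> W"
        using W by (metis openin_prod_topology_alt prod.collapse)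
      then obtain V V' where "V \<in> \<B>" "fst z \<in> V" "V \<subseteq> A" "V' \<in> \<C>" "snd z \<in> V'" "V' \<subseteq> B"
        using \<B>(3) \<C>(3) by meson
      then have "(V, V') \<in> ?I" "z \<in> V \<times> V'"
        using AB(5) by (auto simp: mem_Times_iff)
      then show "z \<in> (\<Union>(V, V')\<in>?I. V \<times> V')"
        by blast
    qed auto
    have "countable ?I"
      by (rule countable_subset[of _ "\<B> \<times> \<C>"]) (use \<B>(1) \<C>(1) in auto)
    moreover have "V \<times> V' \<in> sets (M \<Otimes>\<^sub>M N)" if "(V, V') \<in> ?I" for V V'
      using that \<B>(2) \<C>(2) openin_sets[OF M] openin_sets[OF N] by auto
    ultimately have "(\<Union>i\<in>?I. case i of (V, V') \<Rightarrow> V \<times> V') \<in> sets (M \<Otimes>\<^sub>M N)"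
      by (intro sets.countable_UN'') auto
    then show ?thesis
      using W_eq by simp
  qed
  then have "sigma_sets (space (M \<Otimes>\<^sub>M N)) {W. openin (prod_topology T U) W} \<subseteq> sets (M \<Otimes>\<^sub>M N)"
    by (intro sets.sigma_sets_subset) auto
  then show "borel_sets (prod_topology T U) \<subseteq> sets (M \<Otimes>\<^sub>M N)"
    using M N by (simp add: borel_sets_def space_pair_measure space_eq_topspace)
qed

text \<open>On each pair of fibres over the same value of the countable labels the product measure is
  divided by the common mass of these fibres, which makes the two coordinates conditionally
  independent given the label.\<close>

lemma countable_gluing:
  fixes u :: "'a \<Rightarrow> nat" and v :: "'b \<Rightarrow> nat"
  assumes M: "prob_space M" and N: "prob_space N"
    and [measurable]: "u \<in> measurable M (count_space UNIV)" "v \<in> measurable N (count_space UNIV)"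
    and uv: "distr M (count_space UNIV) u = distr N (count_space UNIV) v"
  obtains \<sigma> where "sets \<sigma> = sets (M \<Otimes>\<^sub>M N)" "distr \<sigma> M fst = M" "distr \<sigma> N snd = N"
    "AE z in \<sigma>. u (fst z) = v (snd z)"
proof -
  interpret M: prob_space M by fact
  interpret N: prob_space N by fact
  interpret pair_sigma_finite M N ..
  define m where "m k = emeasure M (u -` {k} \<inter> space M)" for k
  have m_eq: "m k = emeasure N (v -` {k} \<inter> space N)" for k
    using arg_cong[OF uv, of "\<lambda>D. emeasure D {k}"] by (simp add: m_def emeasure_distr)
  have m_fin: "m k < \<infinity>" for k
    by (simp add: m_def M.emeasure_eq_measure)
  have m_pos_M: "AE x in M. m (u x) \<noteq> 0"
  proof -
    have "u -` {k} \<inter> space M \<in> null_sets M" if "m k = 0" for k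
      using that by (intro null_setsI) (auto simp: m_def)
    then have "AE x in M. \<forall>k\<in>{k. m k = 0}. x \<notin> u -` {k} \<inter> space M"
      by (intro AE_ball_countable[THEN iffD2] ballI AE_not_in) auto
    then show ?thesis
      using AE_space by eventually_elim auto
  qed
  have m_pos_N: "AE x in N. m (v x) \<noteq> 0"
  proof -
    have "v -` {k} \<inter> space N \<in> null_sets N" if "m k = 0" for k
      using that by (intro null_setsI) (auto simp: m_eq)
    then have "AE x in N. \<forall>k\<in>{k. m k = 0}. x \<notin> v -` {k} \<inter> space N"
      by (intro AE_ball_countable[THEN iffD2] ballI AE_not_in) auto
    then show ?thesis
      using AE_space by eventually_elim auto
  qed
  \<comment> \<open>At a label of mass zero the quotient is infinite in \<open>ennreal\<close>; by
    \<open>m_pos_M\<close> and \<open>m_pos_N\<close> such labels are negligible for both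
    factors.\<close>
  define h where "h z = (if u (fst z) = v (snd z) then 1 / m (u (fst z)) else 0)" for z
  have [measurable]: "h \<in> borel_measurable (M \<Otimes>\<^sub>M N)"
  proof -
    have [measurable]: "(\<lambda>z. m (u (fst z))) \<in> borel_measurable (M \<Otimes>\<^sub>M N)"
      by (rule measurable_compose[of "\<lambda>z. u (fst z)" _ "count_space UNIV" m]) simp_all
    \<comment> \<open>Equality of the labels is a countable union of measurable rectangles, one for
      each common value \<open>k\<close>.\<close>
    have "Measurable.pred (M \<Otimes>\<^sub>M N) (\<lambda>z. \<exists>k. u (fst z) = k \<and> v (snd z) = k)"
      by measurable
    then have [measurable]: "Measurable.pred (M \<Otimes>\<^sub>M N) (\<lambda>z. u (fst z) = v (snd z))"
      by (simp add: eq_commute)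
    show ?thesis
      unfolding h_def by measurable
  qed
  have hN: "(\<integral>\<^sup>+y. h (x, y) \<partial>N) = 1" if "m (u x) \<noteq> 0" for x
  proof -
    have "(\<integral>\<^sup>+y. h (x, y) \<partial>N)
        = (\<integral>\<^sup>+y. 1 / m (u x) * indicator (v -` {u x} \<inter> space N) y \<partial>N)"
      by (intro nn_integral_cong) (auto simp: h_def indicator_def)
    also have "\<dots> = 1 / m (u x) * m (u x)"
      by (subst nn_integral_cmult_indicator) (auto simp: m_eq)
    also have "\<dots> = 1"
      using that m_fin[of "u x"] by (simp add: ennreal_divide_times ennreal_divide_self)
    finally show ?thesis .
  qed
  have hM: "(\<integral>\<^sup>+x. h (x, y) \<partial>M) = 1" if "m (v y) \<noteq> 0" for y
  proof -
    have "(\<integral>\<^sup>+x. h (x, y) \<partial>M)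
        = (\<integral>\<^sup>+x. 1 / m (v y) * indicator (u -` {v y} \<inter> space M) x \<partial>M)"
      by (intro nn_integral_cong) (auto simp: h_def indicator_def)
    also have "\<dots> = 1 / m (v y) * m (v y)"
      by (subst nn_integral_cmult_indicator) (auto simp: m_def)
    also have "\<dots> = 1"
      using that m_fin[of "v y"] by (simp add: ennreal_divide_times ennreal_divide_self)
    finally show ?thesis .
  qed
  define \<sigma> where "\<sigma> = density (M \<Otimes>\<^sub>M N) h"
  have sets_\<sigma> [measurable_cong]: "sets \<sigma> = sets (M \<Otimes>\<^sub>M N)"
    by (simp add: \<sigma>_def)
  show ?thesis
  proof
    show "sets \<sigma> = sets (M \<Otimes>\<^sub>M N)" by fact
    show "distr \<sigma> M fst = M"
    proof (rule measure_eqI)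
      fix A assume "A \<in> sets (distr \<sigma> M fst)"
      then have A [measurable]: "A \<in> sets M" by simp
      have "emeasure (distr \<sigma> M fst) A = emeasure \<sigma> (A \<times> space N)"
        by (subst emeasure_distr)
          (auto simp: \<sigma>_def space_pair_measure dest: sets.sets_into_space[OF A, THEN subsetD]
            intro!: arg_cong2[where f = emeasure])
      also have "\<dots> = (\<integral>\<^sup>+z. h z * indicator (A \<times> space N) z \<partial>(M \<Otimes>\<^sub>M N))"
        unfolding \<sigma>_def by (rule emeasure_density) auto
      also have "\<dots> = (\<integral>\<^sup>+x. \<integral>\<^sup>+y. h (x, y) * indicator (A \<times> space N) (x, y) \<partial>N \<partial>M)"
        by (subst N.nn_integral_fst[symmetric]) auto
      also have "\<dots> = (\<integral>\<^sup>+x. indicator A x * (\<integral>\<^sup>+y. h (x, y) \<partial>N) \<partial>M)"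
      proof (rule nn_integral_cong)
        fix x assume [measurable]: "x \<in> space M"
        have "(\<integral>\<^sup>+y. h (x, y) * indicator (A \<times> space N) (x, y) \<partial>N)
            = (\<integral>\<^sup>+y. indicator A x * h (x, y) \<partial>N)"
          by (intro nn_integral_cong) (auto simp: indicator_def)
        also have "\<dots> = indicator A x * (\<integral>\<^sup>+y. h (x, y) \<partial>N)"
          by (rule nn_integral_cmult) measurable
        finally show "(\<integral>\<^sup>+y. h (x, y) * indicator (A \<times> space N) (x, y) \<partial>N)
            = indicator A x * (\<integral>\<^sup>+y. h (x, y) \<partial>N)" .
      qed
      also have "\<dots> = (\<integral>\<^sup>+x. indicator A x \<partial>M)"
        using m_pos_M by (intro nn_integral_cong_AE) (auto simp: hN)
      finally show "emeasure (distr \<sigma> M fst) A = emeasure M A"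
        by simp
    qed simp
    show "distr \<sigma> N snd = N"
    proof (rule measure_eqI)
      fix A assume "A \<in> sets (distr \<sigma> N snd)"
      then have A [measurable]: "A \<in> sets N" by simp
      have "emeasure (distr \<sigma> N snd) A = emeasure \<sigma> (space M \<times> A)"
        by (subst emeasure_distr)
          (auto simp: \<sigma>_def space_pair_measure dest: sets.sets_into_space[OF A, THEN subsetD]
            intro!: arg_cong2[where f = emeasure])
      also have "\<dots> = (\<integral>\<^sup>+z. h z * indicator (space M \<times> A) z \<partial>(M \<Otimes>\<^sub>M N))"
        unfolding \<sigma>_def by (rule emeasure_density) auto
      also have "\<dots> = (\<integral>\<^sup>+y. \<integral>\<^sup>+x. h (x, y) * indicator (space M \<times> A) (x, y) \<partial>M \<partial>N)"
        by (subst nn_integral_snd[symmetric]) auto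
      also have "\<dots> = (\<integral>\<^sup>+y. indicator A y * (\<integral>\<^sup>+x. h (x, y) \<partial>M) \<partial>N)"
      proof (rule nn_integral_cong)
        fix y assume [measurable]: "y \<in> space N"
        have "(\<integral>\<^sup>+x. h (x, y) * indicator (space M \<times> A) (x, y) \<partial>M)
            = (\<integral>\<^sup>+x. indicator A y * h (x, y) \<partial>M)"
          by (intro nn_integral_cong) (auto simp: indicator_def)
        also have "\<dots> = indicator A y * (\<integral>\<^sup>+x. h (x, y) \<partial>M)"
          by (rule nn_integral_cmult) measurable
        finally show "(\<integral>\<^sup>+x. h (x, y) * indicator (space M \<times> A) (x, y) \<partial>M)
            = indicator A y * (\<integral>\<^sup>+x. h (x, y) \<partial>M)" .
      qed
      also have "\<dots> = (\<integral>\<^sup>+y. indicator A y \<partial>N)"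
        using m_pos_N by (intro nn_integral_cong_AE) (auto simp: hM)
      finally show "emeasure (distr \<sigma> N snd) A = emeasure N A"
        by simp
    qed simp
    show "AE z in \<sigma>. u (fst z) = v (snd z)"
      unfolding \<sigma>_def by (subst AE_density) (auto simp: h_def)
  qed
qed

subsection \<open>Geometric data sets\<close>

locale geometric_data =
  fixes X :: "'a data_set"
  assumes geometric: "geometric_data_set X"
begin

sublocale Metric_space "points X" "feature_dist X"
  using geometric by (simp add: geometric_data_set_def)

sublocale law: prob_space "law X"
  using geometric by (simp add: geometric_data_set_def)

lemma data_topology_eq: "data_topology X = mtopology"
  by (simp add: data_topology_def)

lemma topspace_data_topology [simp]: "topspace (data_topology X) = points X"
  by (simp add: data_topology_eq)

lemma sets_law: "sets (law X) = borel_sets (data_topology X)"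
  using geometric by (simp add: geometric_data_set_def)

lemma space_law [simp]: "space (law X) = points X"
  using space_eq_topspace[OF sets_law] by simp

lemma points_nonempty: "points X \<noteq> {}" and features_nonempty: "features X \<noteq> {}"
  using geometric by (auto simp: geometric_data_set_def)

lemma complete: "mcomplete"
  using geometric by (simp add: geometric_data_set_def)

lemma mball_sets [measurable]: "mball x r \<in> sets (law X)"
  by (rule openin_sets[OF sets_law]) (simp add: data_topology_eq)

lemma measure_mball_pos:
  assumes "x \<in> points X" "0 < r"
  shows "0 < measure (law X) (mball x r)"
proof -
  have "x \<in> topological_support (data_topology X) (law X)"
    using geometric assms by (simp add: geometric_data_set_def)
  then have "0 < emeasure (law X) (mball x r)"
    using assms by (simp add: topological_support_def data_topology_eq)
  then show ?thesis
    by (simp add: law.emeasure_eq_measure)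
qed

lemma feature_Lipschitz:
  assumes "f \<in> features X" "x \<in> points X" "y \<in> points X"
  shows "\<bar>f x - f y\<bar> \<le> feature_dist X x y"
proof -
  have "bdd_above ((\<lambda>f. \<bar>f x - f y\<bar>) ` features X)"
    using geometric assms by (auto simp: geometric_data_set_def)
  then show ?thesis
    using assms by (auto simp: feature_dist_def intro: cSUP_upper2)
qed

lemma feature_dist_le:
  assumes "x \<in> points X" "y \<in> points X" "\<And>f. f \<in> features X \<Longrightarrow> \<bar>f x - f y\<bar> \<le> c"
  shows "feature_dist X x y \<le> c"
  using assms features_nonempty by (auto simp: feature_dist_def intro: cSUP_least)

text \<open>Indexing a dense set by \<open>nat\<close>, possibly with repetitions, permits least
  indices, finite initial segments and diagonal subsequences later on.\<close>

lemma dense_sequence: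
  obtains s :: "nat \<Rightarrow> 'a" where "\<And>k. s k \<in> points X"
    "\<And>x r. x \<in> points X \<Longrightarrow> 0 < r \<Longrightarrow> \<exists>k. feature_dist X (s k) x < r"
proof -
  obtain U where U: "countable U" "U \<subseteq> points X" "mtopology closure_of U = points X"
    using geometric by (auto simp: geometric_data_set_def separable_space_def data_topology_eq)
  have "U \<noteq> {}"
    using U(3) points_nonempty by auto
  then have s: "range (from_nat_into U) = U"
    using U(1) by (rule range_from_nat_into)
  show ?thesis
  proof
    show "from_nat_into U k \<in> points X" for k
      by (rule subsetD[OF U(2) from_nat_into[OF \<open>U \<noteq> {}\<close>]])
    fix x r assume "x \<in> points X" and r: "0 < (r::real)"
    then have "x \<in> mtopology closure_of U"
      by (simp add: U(3))
    then have "\<exists>y\<in>U. y \<in> mball x r"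
      using r by (simp add: metric_closure_of)
    then obtain y where "y \<in> U" "feature_dist X x y < r"
      by auto
    then have y: "y \<in> U" "feature_dist X y x < r"
      by (simp_all add: commute[of y x])
    then obtain k where "y = from_nat_into U k"
      using s by blast
    then show "\<exists>k. feature_dist X (from_nat_into U k) x < r"
      using y(2) by blast
  qed
qed

lemma second_countable: "second_countable (data_topology X)"
proof -
  obtain s :: "nat \<Rightarrow> 'a" where s: "\<And>k. s k \<in> points X"
    "\<And>x r. x \<in> points X \<Longrightarrow> 0 < r \<Longrightarrow> \<exists>k. feature_dist X (s k) x < r"
    by (rule dense_sequence) (rule that)
  let ?B = "(\<lambda>(k, n). mball (s k) (1 / real (Suc n))) ` UNIV"
  have "\<exists>V\<in>?B. x \<in> V \<and> V \<subseteq> U" if U: "openin mtopology U" "x \<in> U" for U x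
  proof -
    obtain r where r: "0 < r" "mball x r \<subseteq> U" and x: "x \<in> points X"
      using U unfolding openin_mtopology by (meson subsetD)
    obtain n where n: "1 / real (Suc n) < r / 2"
      using r(1) by (metis half_gt_zero nat_approx_posE)
    obtain k where k: "feature_dist X (s k) x < 1 / real (Suc n)"
      using s(2)[OF x, of "1 / real (Suc n)"] by auto
    have "feature_dist X x (s k) + 1 / real (Suc n) \<le> r"
      using n k commute[of x "s k"] by simp
    then have "mball (s k) (1 / real (Suc n)) \<subseteq> mball x r"
      using mball_subset[of "s k" x "1 / real (Suc n)" r] x commute[of x "s k"] by simp
    moreover have "x \<in> mball (s k) (1 / real (Suc n))"
      using k x s(1) by simp
    ultimately show ?thesis
      using r(2) by (intro bexI[of _ "mball (s k) (1 / real (Suc n))"]) auto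
  qed
  moreover have "countable ?B" "\<forall>V\<in>?B. openin mtopology V"
    by auto
  ultimately show ?thesis
    unfolding second_countable_def data_topology_eq by blast
qed

text \<open>A substitute for tightness: instead of a compact set, finitely many small balls carry
  almost all mass, so that information at their centres suffices.\<close>

lemma finite_balls_large_mass:
  assumes "\<And>k. s k \<in> points X"
    and dense: "\<And>x r. x \<in> points X \<Longrightarrow> 0 < r \<Longrightarrow> \<exists>k. feature_dist X (s k) x < r"
    and "0 < r" "0 < \<delta>"
  obtains N :: nat where "1 - \<delta> < measure (law X) (\<Union>k<N. mball (s k) r)"
proof -
  let ?A = "\<lambda>N. \<Union>k<N. mball (s k) r"
  have "(\<lambda>N. measure (law X) (?A N)) \<longlonglongrightarrow> measure (law X) (\<Union>N. ?A N)"
  proof (rule law.finite_Lim_measure_incseq)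
    show "incseq ?A"
      by (intro monoI UN_mono) auto
  qed auto
  moreover have "(\<Union>N. ?A N) = points X"
    using assms(1) dense[OF _ \<open>0 < r\<close>] by (fastforce intro: lessI)
  ultimately have "(\<lambda>N. measure (law X) (?A N)) \<longlonglongrightarrow> 1"
    using law.prob_space by simp
  then have "eventually (\<lambda>N. 1 - \<delta> < measure (law X) (?A N)) sequentially"
    by (rule order_tendstoD) (use \<open>0 < \<delta>\<close> in simp)
  then show ?thesis
    using that by (auto simp: eventually_sequentially)
qed

end

section \<open>Matching features along a relation\<close>

text \<open>Stands for a Hausdorff distance of at most \<open>c\<close> on \<open>S\<close>, except
  that a partner within \<open>c\<close> must exist instead of being approached by an infimum. A
  strict bound on the Hausdorff distance provides such partners. \<open>S\<close> is an arbitrary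
  relation, so converse and composition are available.\<close>

definition features_close :: "'a data_set \<Rightarrow> 'b data_set \<Rightarrow> ('a \<times> 'b) set \<Rightarrow> real \<Rightarrow> bool" where
  "features_close X Y S c \<longleftrightarrow>
     (\<forall>f\<in>features X. \<exists>g\<in>features Y. \<forall>(x, y)\<in>S. \<bar>f x - g y\<bar> \<le> c) \<and>
     (\<forall>g\<in>features Y. \<exists>f\<in>features X. \<forall>(x, y)\<in>S. \<bar>f x - g y\<bar> \<le> c)"

lemma features_close_converse: "features_close X Y S c \<Longrightarrow> features_close Y X (S\<inverse>) c"
  by (fastforce simp: features_close_def abs_minus_commute)

lemma features_close_mono:
  assumes "features_close X Y S c" "T \<subseteq> S" "c \<le> c'"
  shows "features_close X Y T c'"
proof -
  have "\<forall>(x, y)\<in>T. \<bar>f x - g y\<bar> \<le> c'" if "\<forall>(x, y)\<in>S. \<bar>f x - g y\<bar> \<le> c"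
    for f :: "'a \<Rightarrow> real" and g :: "'b \<Rightarrow> real"
    using that assms(2,3) by force
  then show ?thesis
    using assms(1) unfolding features_close_def by meson
qed

lemma features_close_relcomp:
  assumes "features_close X Y S c" "features_close Y Z T d"
  shows "features_close X Z (S O T) (c + d)"
proof -
  have *: "\<forall>(x, z)\<in>S O T. \<bar>f x - h z\<bar> \<le> c + d"
    if "\<forall>(x, y)\<in>S. \<bar>f x - g y\<bar> \<le> c" "\<forall>(y, z)\<in>T. \<bar>g y - h z\<bar> \<le> d"
    for f :: "'a \<Rightarrow> real" and g :: "'b \<Rightarrow> real" and h :: "'c \<Rightarrow> real"
    using that by (fastforce simp: abs_le_iff)
  show ?thesis
    unfolding features_close_def
  proof (intro conjI ballI)
    fix f assume "f \<in> features X"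
    then obtain g where g: "g \<in> features Y" "\<forall>(x, y)\<in>S. \<bar>f x - g y\<bar> \<le> c"
      using assms(1) unfolding features_close_def by blast
    then obtain h where "h \<in> features Z" "\<forall>(y, z)\<in>T. \<bar>g y - h z\<bar> \<le> d"
      using assms(2) unfolding features_close_def by blast
    then show "\<exists>h\<in>features Z. \<forall>(x, z)\<in>S O T. \<bar>f x - h z\<bar> \<le> c + d"
      using * g(2) by blast
  next
    fix h assume "h \<in> features Z"
    then obtain g where g: "g \<in> features Y" "\<forall>(y, z)\<in>T. \<bar>g y - h z\<bar> \<le> d"
      using assms(2) unfolding features_close_def by blast
    then obtain f where "f \<in> features X" "\<forall>(x, y)\<in>S. \<bar>f x - g y\<bar> \<le> c"
      using assms(1) unfolding features_close_def by blast
    then show "\<exists>f\<in>features X. \<forall>(x, z)\<in>S O T. \<bar>f x - h z\<bar> \<le> c + d"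
      using * g(2) by blast
  qed
qed

locale data_pair = X: geometric_data X + Y: geometric_data Y
  for X :: "'a data_set" and Y :: "'b data_set"
begin

abbreviation "pair_topology \<equiv> prod_topology (data_topology X) (data_topology Y)"

text \<open>Features on both sides are 1-Lipschitz, so displacing each coordinate by at most
  \<open>r\<close> costs \<open>2 * r\<close>. Passing to closures, to cells, to balls and to limits
  all rest on this estimate.\<close>

lemma features_close_perturb:
  assumes close: "features_close X Y S c" and S: "S \<subseteq> points X \<times> points Y"
    and T: "T \<subseteq> points X \<times> points Y"
    and near: "\<And>a b. (a, b) \<in> T \<Longrightarrow>
      \<exists>(x, y)\<in>S. feature_dist X a x \<le> r \<and> feature_dist Y b y \<le> r"
  shows "features_close X Y T (c + 2 * r)"
proof -
  have *: "\<forall>(a, b)\<in>T. \<bar>f a - g b\<bar> \<le> c + 2 * r"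
    if f: "f \<in> features X" and g: "g \<in> features Y" and fg: "\<forall>(x, y)\<in>S. \<bar>f x - g y\<bar> \<le> c" for f g
  proof clarify
    fix a b assume ab: "(a, b) \<in> T"
    then obtain x y where xy: "(x, y) \<in> S" "feature_dist X a x \<le> r" "feature_dist Y b y \<le> r"
      using near by blast
    then have "\<bar>f a - f x\<bar> \<le> feature_dist X a x" "\<bar>g b - g y\<bar> \<le> feature_dist Y b y"
      using X.feature_Lipschitz[OF f, of a x] Y.feature_Lipschitz[OF g, of b y] ab S T by auto
    moreover have "\<bar>f x - g y\<bar> \<le> c"
      using fg xy by blast
    ultimately show "\<bar>f a - g b\<bar> \<le> c + 2 * r"
      using xy(2,3)
      by linarith
  qed
  show ?thesis
    using close * unfolding features_close_def by meson
qed

text \<open>The metric is the supremum of the increments of the features, and replacing a feature by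
  its partner alters an increment by at most \<open>c\<close> at each end.\<close>

lemma features_close_dist:
  assumes "features_close X Y S c" "S \<subseteq> points X \<times> points Y" "(x, y) \<in> S" "(x', y') \<in> S"
  shows "\<bar>feature_dist X x x' - feature_dist Y y y'\<bar> \<le> 2 * c"
proof -
  have xy: "x \<in> points X" "x' \<in> points X" "y \<in> points Y" "y' \<in> points Y"
    using assms by auto
  have "feature_dist X x x' \<le> feature_dist Y y y' + 2 * c"
  proof (rule X.feature_dist_le)
    fix f assume "f \<in> features X"
    then obtain g where g: "g \<in> features Y" "\<forall>(x, y)\<in>S. \<bar>f x - g y\<bar> \<le> c"
      using assms(1) unfolding features_close_def by blast
    then have "\<bar>f x - g y\<bar> \<le> c" "\<bar>f x' - g y'\<bar> \<le> c"
      using assms by auto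
    with Y.feature_Lipschitz[OF g(1) xy(3,4)]
    show "\<bar>f x - f x'\<bar> \<le> feature_dist Y y y' + 2 * c"
      by linarith
  qed (use xy in auto)
  moreover have "feature_dist Y y y' \<le> feature_dist X x x' + 2 * c"
  proof (rule Y.feature_dist_le)
    fix g assume "g \<in> features Y"
    then obtain f where f: "f \<in> features X" "\<forall>(x, y)\<in>S. \<bar>f x - g y\<bar> \<le> c"
      using assms(1) unfolding features_close_def by blast
    then have "\<bar>f x - g y\<bar> \<le> c" "\<bar>f x' - g y'\<bar> \<le> c"
      using assms by auto
    with X.feature_Lipschitz[OF f(1) xy(1,2)]
    show "\<bar>g y - g y'\<bar> \<le> feature_dist X x x' + 2 * c"
      by linarith
  qed (use xy in auto)
  ultimately show ?thesis
    by linarith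
qed

lemma sets_pair_law: "sets (law X \<Otimes>\<^sub>M law Y) = borel_sets pair_topology"
  by (rule sets_pair_eq_borel_sets)
    (auto simp: X.second_countable Y.second_countable X.sets_law Y.sets_law)

lemma couplings_iff:
  "\<pi> \<in> couplings X Y \<longleftrightarrow> prob_space \<pi> \<and> sets \<pi> = sets (law X \<Otimes>\<^sub>M law Y) \<and>
     distr \<pi> (law X) fst = law X \<and> distr \<pi> (law Y) snd = law Y"
  by (simp add: couplings_def sets_pair_law)

lemma coupling_space:
  assumes "\<pi> \<in> couplings X Y"
  shows "space \<pi> = points X \<times> points Y"
  using assms sets_eq_imp_space_eq[of \<pi> "law X \<Otimes>\<^sub>M law Y"]
  by (simp add: couplings_iff space_pair_measure)

lemma coupling_measurable:
  assumes "\<pi> \<in> couplings X Y"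
  shows "fst \<in> measurable \<pi> (law X)" "snd \<in> measurable \<pi> (law Y)"
proof -
  have [measurable_cong]: "sets \<pi> = sets (law X \<Otimes>\<^sub>M law Y)"
    using assms by (simp add: couplings_iff)
  show "fst \<in> measurable \<pi> (law X)" "snd \<in> measurable \<pi> (law Y)"
    by measurable
qed

text \<open>Gluing along a constant label gives the product measure; its total mass is read off from
  a marginal.\<close>

lemma couplings_nonempty: "couplings X Y \<noteq> {}"
proof -
  have "distr (law X) (count_space UNIV) (\<lambda>_. 0 :: nat) = distr (law Y) (count_space UNIV) (\<lambda>_. 0)"
    by (simp add: X.law.distr_const Y.law.distr_const)
  then obtain \<sigma> where \<sigma>: "sets \<sigma> = sets (law X \<Otimes>\<^sub>M law Y)"
      "distr \<sigma> (law X) fst = law X" "distr \<sigma> (law Y) snd = law Y"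
    using countable_gluing[OF X.law.prob_space_axioms Y.law.prob_space_axioms
        measurable_const measurable_const] by (metis UNIV_I space_count_space)
  have "fst \<in> measurable \<sigma> (law X)"
    using measurable_fst measurable_cong_sets[OF \<sigma>(1) refl] by blast
  then have "prob_space \<sigma>"
    using \<sigma>(2) X.law.prob_space_axioms by (metis prob_space_distrD)
  then show ?thesis
    using \<sigma> couplings_iff by blast
qed

text \<open>The strip over \<open>A\<close> is covered by the strip over \<open>B\<close> and the
  complement of \<open>S\<close>, and the latter has mass at most \<open>e\<close>.\<close>

lemma coupling_mass_le:
  assumes \<pi>: "\<pi> \<in> couplings X Y" and S: "S \<in> sets \<pi>" "1 - e \<le> measure \<pi> S"
    and A: "A \<in> sets (law X)" and B: "B \<in> sets (law Y)"
    and AB: "\<And>x y. (x, y) \<in> S \<Longrightarrow> x \<in> A \<Longrightarrow> y \<in> B"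
  shows "measure (law X) A \<le> measure (law Y) B + e"
proof -
  interpret \<pi>: prob_space \<pi>
    using \<pi> by (simp add: couplings_iff)
  note [measurable] = coupling_measurable[OF \<pi>] S(1) A B
  have "measure (law X) A = measure (distr \<pi> (law X) fst) A"
    using \<pi> by (simp add: couplings_iff)
  also have "\<dots> = measure \<pi> (fst -` A \<inter> space \<pi>)"
    by (rule measure_distr) auto
  also have "\<dots> \<le> measure \<pi> ((snd -` B \<inter> space \<pi>) \<union> (space \<pi> - S))"
    using AB by (intro \<pi>.finite_measure_mono) auto
  also have "\<dots> \<le> measure \<pi> (snd -` B \<inter> space \<pi>) + measure \<pi> (space \<pi> - S)"
    by (intro measure_Un_le) auto
  also have "measure \<pi> (snd -` B \<inter> space \<pi>) = measure (distr \<pi> (law Y) snd) B"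
    by (rule measure_distr[symmetric]) auto
  also have "\<dots> = measure (law Y) B"
    using \<pi> by (simp add: couplings_iff)
  also have "measure \<pi> (space \<pi> - S) \<le> e"
    using S \<pi>.prob_compl by simp
  finally show ?thesis by simp
qed

lemma coupling_swap:
  assumes \<pi>: "\<pi> \<in> couplings X Y"
  shows "distr \<pi> (law Y \<Otimes>\<^sub>M law X) prod.swap \<in> couplings Y X"
proof -
  interpret YX: data_pair Y X ..
  interpret \<pi>: prob_space \<pi>
    using \<pi> by (simp add: couplings_iff)
  note [measurable] = coupling_measurable[OF \<pi>]
  have [measurable]: "prod.swap \<in> measurable \<pi> (law Y \<Otimes>\<^sub>M law X)"
    unfolding prod.swap_def by measurable
  show ?thesis
    unfolding YX.couplings_iff
    using \<pi> by (auto intro!: \<pi>.prob_space_distr simp: distr_distr comp_def couplings_iff)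
qed


section \<open>Box distance in terms of couplings and matched features\<close>

text \<open>Makes witnesses easy to give: \<open>S\<close> may be neither closed nor measurable. Its
  closure is the actual witness, since each point of the closure is arbitrarily near to
  \<open>S\<close> and \<open>features_close_perturb\<close> makes the loss arbitrarily
  small.\<close>

lemma box_distance_leI:
  assumes \<pi>: "\<pi> \<in> couplings X Y" and S: "S \<subseteq> points X \<times> points Y"
    and close: "features_close X Y S c" and c: "0 \<le> c"
    and mass: "\<And>T. closedin pair_topology T \<Longrightarrow> S \<subseteq> T \<Longrightarrow> 1 - 2 * c \<le> measure \<pi> T"
  shows "box_distance X Y \<le> ennreal (2 * c)"
proof (rule ennreal_le_epsilon)
  fix e :: real assume e: "0 < e"
  interpret \<pi>: prob_space \<pi>
    using \<pi> by (simp add: couplings_iff)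
  define T where "T = pair_topology closure_of S"
  have T: "closedin pair_topology T" "S \<subseteq> T" "T \<subseteq> points X \<times> points Y"
    using S closure_of_subset[of S pair_topology] closure_of_subset_topspace[of pair_topology S]
    by (simp_all add: T_def)
  \<comment> \<open>The displacement costs \<open>2 * r\<close>, which the factor 2 of the box
    distance turns into \<open>e\<close>.\<close>
  define r where "r = e / 4"
  have r: "0 < r" "2 * (c + 2 * r) = 2 * c + e"
    using e by (simp_all add: r_def)
  have T_close: "features_close X Y T (c + 2 * r)"
  proof (rule features_close_perturb[OF close S T(3)])
    fix a b assume ab: "(a, b) \<in> T"
    have op: "openin pair_topology (X.mball a r \<times> Y.mball b r)"
      by (simp add: openin_prod_Times_iff X.data_topology_eq Y.data_topology_eq)
    have "(a, b) \<in> X.mball a r \<times> Y.mball b r"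
      using ab T(3) r(1) by auto
    then obtain z where z: "z \<in> S" "z \<in> X.mball a r \<times> Y.mball b r"
      using ab op unfolding T_def in_closure_of by metis
    show "\<exists>(x, y)\<in>S. feature_dist X a x \<le> r \<and> feature_dist Y b y \<le> r"
      by (rule bexI[OF _ z(1)]) (use z(2) in auto)
  qed
  have sup: "sup_dist_on T (f \<circ> fst) (g \<circ> snd) \<le> ennreal (c + 2 * r)"
    if "\<forall>(x, y)\<in>T. \<bar>f x - g y\<bar> \<le> c + 2 * r" for f :: "'a \<Rightarrow> real" and g :: "'b \<Rightarrow> real"
    unfolding sup_dist_on_def using that by (intro SUP_least) (auto intro!: ennreal_leI)
  let ?F = "(\<lambda>f. f \<circ> fst) ` features X :: ('a \<times> 'b \<Rightarrow> real) set"
    and ?G = "(\<lambda>g. g \<circ> snd) ` features Y :: ('a \<times> 'b \<Rightarrow> real) set"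
  have "hausdorff_distance (sup_dist_on T) ?F ?G \<le> ennreal (c + 2 * r)"
    unfolding hausdorff_distance_def
  proof (intro max.boundedI SUP_least)
    fix a assume "a \<in> ?F"
    then obtain g f where "a = f \<circ> fst" "g \<in> features Y" "\<forall>(x, y)\<in>T. \<bar>f x - g y\<bar> \<le> c + 2 * r"
      using T_close unfolding features_close_def by blast
    then show "(INF b\<in>?G. sup_dist_on T a b) \<le> ennreal (c + 2 * r)"
      using sup by (intro INF_lower2[of "g \<circ> snd"]) auto
  next
    fix b assume "b \<in> ?G"
    then obtain f g where "b = g \<circ> snd" "f \<in> features X" "\<forall>(x, y)\<in>T. \<bar>f x - g y\<bar> \<le> c + 2 * r"
      using T_close unfolding features_close_def by blast
    then show "(INF a\<in>?F. sup_dist_on T a b) \<le> ennreal (c + 2 * r)"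
      using sup by (intro INF_lower2[of "f \<circ> fst"]) auto
  qed
  then have "2 * hausdorff_distance (sup_dist_on T) ?F ?G \<le> ennreal 2 * ennreal (c + 2 * r)"
    by (simp add: mult_left_mono)
  also have "\<dots> = ennreal (2 * c + e)"
    using c r by (subst ennreal_mult[symmetric]) auto
  finally have H: "2 * hausdorff_distance (sup_dist_on T) ?F ?G \<le> ennreal (2 * c + e)" .
  have "1 - emeasure \<pi> T = ennreal (1 - measure \<pi> T)"
    by (simp add: \<pi>.emeasure_eq_measure flip: ennreal_1 ennreal_minus)
  also have "\<dots> \<le> ennreal (2 * c + e)"
    using mass[OF T(1,2)] e by (intro ennreal_leI) linarith
  finally have "max (1 - emeasure \<pi> T) (2 * hausdorff_distance (sup_dist_on T) ?F ?G)
      \<le> ennreal (2 * c + e)"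
    using H by simp
  then have "box_distance X Y \<le> ennreal (2 * c + e)"
    unfolding box_distance_def using \<pi> T(1)
    by (intro INF_lower2[of \<pi>] INF_lower2[of T]) auto
  then show "box_distance X Y \<le> ennreal (2 * c) + ennreal e"
    using c e by simp
qed

text \<open>Strictness is what turns the infima into witnesses, both for the coupling with its
  closed set and for the partner of each feature.\<close>

lemma box_distance_lessD:
  assumes "box_distance X Y < ennreal (2 * c)"
  obtains \<pi> S where "\<pi> \<in> couplings X Y" "closedin pair_topology S" "1 - 2 * c < measure \<pi> S"
    "features_close X Y S c"
proof -
  let ?F = "(\<lambda>f. f \<circ> fst) ` features X :: ('a \<times> 'b \<Rightarrow> real) set"
    and ?G = "(\<lambda>g. g \<circ> snd) ` features Y :: ('a \<times> 'b \<Rightarrow> real) set"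
  \<comment> \<open>For nonpositive \<open>c\<close> the bound \<open>ennreal (2 * c)\<close> would
    be 0, and nothing lies strictly below 0.\<close>
  have c: "0 < c"
    using assms by (metis ennreal_neg linorder_not_le mult_nonneg_nonpos not_less_zero zero_le_numeral)
  obtain \<pi> S where \<pi>: "\<pi> \<in> couplings X Y" and S: "closedin pair_topology S"
    and less: "1 - emeasure \<pi> S < ennreal (2 * c)"
      "2 * hausdorff_distance (sup_dist_on S) ?F ?G < ennreal (2 * c)"
    using assms unfolding box_distance_def by (auto simp: INF_less_iff)
  interpret \<pi>: prob_space \<pi>
    using \<pi> by (simp add: couplings_iff)
  have "ennreal (1 - measure \<pi> S) < ennreal (2 * c)"
    using less(1) by (simp add: \<pi>.emeasure_eq_measure flip: ennreal_1 ennreal_minus)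
  then have mass: "1 - 2 * c < measure \<pi> S"
    using c by (auto simp: ennreal_less_iff)
  have "hausdorff_distance (sup_dist_on S) ?F ?G < ennreal c"
  proof (rule ccontr)
    assume "\<not> ?thesis"
    then have "ennreal 2 * ennreal c \<le> 2 * hausdorff_distance (sup_dist_on S) ?F ?G"
      by (simp add: mult_left_mono)
    then show False
      using less(2) c by (simp add: ennreal_mult)
  qed
  then have H: "(SUP a\<in>?F. INF b\<in>?G. sup_dist_on S a b) < ennreal c"
      "(SUP b\<in>?G. INF a\<in>?F. sup_dist_on S a b) < ennreal c"
    by (simp_all add: hausdorff_distance_def)
  have pointwise: "\<forall>(x, y)\<in>S. \<bar>f x - g y\<bar> \<le> c" if "sup_dist_on S (f \<circ> fst) (g \<circ> snd) < ennreal c"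
    for f :: "'a \<Rightarrow> real" and g :: "'b \<Rightarrow> real"
  proof clarify
    fix x y assume "(x, y) \<in> S"
    then have "ennreal \<bar>f x - g y\<bar> \<le> sup_dist_on S (f \<circ> fst) (g \<circ> snd)"
      unfolding sup_dist_on_def by (intro SUP_upper2[of "(x, y)"]) auto
    then have "ennreal \<bar>f x - g y\<bar> < ennreal c"
      using that by simp
    then show "\<bar>f x - g y\<bar> \<le> c"
      by (simp add: ennreal_less_iff)
  qed
  have "features_close X Y S c"
    unfolding features_close_def
  proof (intro conjI ballI)
    fix f assume "f \<in> features X"
    then have "(INF b\<in>?G. sup_dist_on S (f \<circ> fst) b) < ennreal c"
      by (intro le_less_trans[OF SUP_upper[of "f \<circ> fst"] H(1)]) auto
    then obtain g where "g \<in> features Y" "sup_dist_on S (f \<circ> fst) (g \<circ> snd) < ennreal c"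
      by (auto simp: INF_less_iff)
    then show "\<exists>g\<in>features Y. \<forall>(x, y)\<in>S. \<bar>f x - g y\<bar> \<le> c"
      by (intro bexI[of _ g] pointwise)
  next
    fix g assume "g \<in> features Y"
    then have "(INF a\<in>?F. sup_dist_on S a (g \<circ> snd)) < ennreal c"
      by (intro le_less_trans[OF SUP_upper[of "g \<circ> snd"] H(2)]) auto
    then obtain f where "f \<in> features X" "sup_dist_on S (f \<circ> fst) (g \<circ> snd) < ennreal c"
      by (auto simp: INF_less_iff)
    then show "\<exists>f\<in>features X. \<forall>(x, y)\<in>S. \<bar>f x - g y\<bar> \<le> c"
      by (intro bexI[of _ f] pointwise)
  qed
  with \<pi> S mass show ?thesis
    by (rule that)
qed

lemma closedin_subset_points: "closedin pair_topology S \<Longrightarrow> S \<subseteq> points X \<times> points Y"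
  using closedin_subset[of pair_topology S] by simp

lemma closedin_coupling_sets:
  assumes "\<pi> \<in> couplings X Y" "closedin pair_topology S"
  shows "S \<in> sets \<pi>"
  using assms closedin_sets[of \<pi> pair_topology S] by (simp add: couplings_iff sets_pair_law)

text \<open>On the empty set all features match, at the price of losing the whole mass;
  \<open>2 * c = 1\<close> pays for this.\<close>

lemma box_distance_le_1: "box_distance X Y \<le> 1"
proof -
  obtain \<pi> where "\<pi> \<in> couplings X Y"
    using couplings_nonempty by auto
  then have "box_distance X Y \<le> ennreal (2 * (1 / 2))"
    by (rule box_distance_leI[where S = "{}"])
      (use X.features_nonempty Y.features_nonempty in \<open>auto simp: features_close_def\<close>)
  then show ?thesis
    by simp
qed

lemma box_distance_commute_le: "box_distance Y X \<le> box_distance X Y"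
proof (rule ennreal_le_epsilon)
  interpret YX: data_pair Y X ..
  fix e :: real assume e: "0 < e"
  define c where "c = (enn2real (box_distance X Y) + e) / 2"
  have fin: "box_distance X Y = ennreal (enn2real (box_distance X Y))"
    using box_distance_le_1 by (simp add: ennreal_enn2real_if) (metis ennreal_one_neq_top top.extremum_unique)
  have c: "ennreal (2 * c) = box_distance X Y + ennreal e" "0 \<le> c"
  proof -
    have "2 * c = enn2real (box_distance X Y) + e"
      by (simp add: c_def)
    then show "ennreal (2 * c) = box_distance X Y + ennreal e"
      using e fin by (simp add: ennreal_plus)
    show "0 \<le> c"
      using e by (simp add: c_def)
  qed
  have "box_distance X Y < ennreal (2 * c)"
    using e unfolding c_def by (subst fin) (simp add: ennreal_less_iff)
  then obtain \<pi> S where \<pi>: "\<pi> \<in> couplings X Y" and S: "closedin pair_topology S"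
    and mass: "1 - 2 * c < measure \<pi> S" and close: "features_close X Y S c"
    by (rule box_distance_lessD)
  interpret \<pi>: prob_space \<pi>
    using \<pi> by (simp add: couplings_iff)
  have "box_distance Y X \<le> ennreal (2 * c)"
  proof (rule YX.box_distance_leI[OF coupling_swap[OF \<pi>]])
    show "S\<inverse> \<subseteq> points Y \<times> points X"
      using closedin_subset_points[OF S] by auto
    show "features_close Y X (S\<inverse>) c"
      using close by (rule features_close_converse)
    fix T assume T: "closedin YX.pair_topology T" "S\<inverse> \<subseteq> T"
    note [measurable] = coupling_measurable[OF \<pi>]
    have swap: "prod.swap \<in> measurable \<pi> (law Y \<Otimes>\<^sub>M law X)"
      unfolding prod.swap_def by measurable
    have T_sets: "T \<in> sets (law Y \<Otimes>\<^sub>M law X)"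
      using closedin_sets[OF YX.sets_pair_law T(1)] .
    \<comment> \<open>The preimage of \<open>T\<close> under the swap contains \<open>S\<close>, so
      closed supersets of the converse relation inherit the mass of \<open>S\<close>.\<close>
    have "measure \<pi> S \<le> measure \<pi> (prod.swap -` T \<inter> space \<pi>)"
      using T(2) closedin_subset_points[OF S] measurable_sets[OF swap T_sets] coupling_space[OF \<pi>]
      by (intro \<pi>.finite_measure_mono) auto
    also have "\<dots> = measure (distr \<pi> (law Y \<Otimes>\<^sub>M law X) prod.swap) T"
      by (rule measure_distr[OF swap T_sets, symmetric])
    finally show "1 - 2 * c \<le> measure (distr \<pi> (law Y \<Otimes>\<^sub>M law X) prod.swap) T"
      using mass by simp
  qed (use c in auto)
  then show "box_distance Y X \<le> box_distance X Y + ennreal e"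
    by (simp add: c)
qed

lemma box_distance_commute: "box_distance X Y = box_distance Y X"
proof -
  interpret YX: data_pair Y X ..
  show ?thesis
    using box_distance_commute_le YX.box_distance_commute_le by (rule antisym[rotated])
qed

end


section \<open>Triangle inequality\<close>

text \<open>The label of a point is the first ball of radius \<open>r / 2\<close> around a dense
  sequence that contains it, so two points with the same label share a centre.\<close>

lemma (in geometric_data) countable_small_cells:
  assumes r: "0 < r"
  obtains cell :: "'a \<Rightarrow> nat" where "cell \<in> measurable (law X) (count_space UNIV)"
    "\<And>x y. x \<in> points X \<Longrightarrow> y \<in> points X \<Longrightarrow> cell x = cell y \<Longrightarrow> feature_dist X x y \<le> r"
proof -
  obtain s :: "nat \<Rightarrow> 'a" where s: "\<And>k. s k \<in> points X"
    "\<And>x r. x \<in> points X \<Longrightarrow> 0 < r \<Longrightarrow> \<exists>k. feature_dist X (s k) x < r"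
    by (rule dense_sequence) (rule that)
  define cell where "cell x = (LEAST k. x \<in> mball (s k) (r / 2))" for x
  show ?thesis
  proof
    have [measurable]: "Measurable.pred (law X) (\<lambda>x. x \<in> mball (s k) (r / 2))" for k
      by (rule pred_sets2[OF mball_sets]) simp
    show "cell \<in> measurable (law X) (count_space UNIV)"
      unfolding cell_def by measurable
    have cell: "feature_dist X (s (cell x)) x < r / 2" if x: "x \<in> points X" for x
    proof -
      obtain k where "x \<in> mball (s k) (r / 2)"
        using s(1) s(2)[OF x, of "r / 2"] x r by auto
      then have "x \<in> mball (s (cell x)) (r / 2)"
        unfolding cell_def by (rule LeastI)
      then show ?thesis
        by simp
    qed
    fix x y assume xy: "x \<in> points X" "y \<in> points X" "cell x = cell y"
    have "feature_dist X x y \<le> feature_dist X (s (cell x)) x + feature_dist X (s (cell x)) y"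
      using xy s(1) by (intro triangle'') auto
    then show "feature_dist X x y \<le> r"
      using cell[OF xy(1)] cell[OF xy(2)] xy(3) by simp
  qed
qed

text \<open>The glued measure makes the two middle points agree only up to a common cell. The term
  \<open>2 * r\<close> is the price of treating them as equal, and it can be made as small as
  desired.\<close>

lemma box_distance_glue:
  fixes X :: "'a data_set" and Y :: "'b data_set" and Z :: "'c data_set"
  assumes "geometric_data_set X" "geometric_data_set Y" "geometric_data_set Z"
    and less: "box_distance X Y < ennreal (2 * c)" "box_distance Y Z < ennreal (2 * d)"
    and r: "0 < r"
  shows "box_distance X Z \<le> ennreal (2 * (c + d + 2 * r))"
proof -
  interpret XY: data_pair X Y using assms by unfold_locales
  interpret YZ: data_pair Y Z using assms by unfold_locales
  interpret XZ: data_pair X Z ..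
  obtain \<pi> S where \<pi>: "\<pi> \<in> couplings X Y" and S: "closedin XY.pair_topology S"
    and \<pi>_mass: "1 - 2 * c < measure \<pi> S" and S_close: "features_close X Y S c"
    using less(1) by (rule XY.box_distance_lessD)
  obtain \<rho> T where \<rho>: "\<rho> \<in> couplings Y Z" and T: "closedin YZ.pair_topology T"
    and \<rho>_mass: "1 - 2 * d < measure \<rho> T" and T_close: "features_close Y Z T d"
    using less(2) by (rule YZ.box_distance_lessD)
  have pos: "0 < c" "0 < d"
    using less by (metis ennreal_neg linorder_not_le mult_nonneg_nonpos not_less_zero zero_le_numeral)+
  note S_sub = XY.closedin_subset_points[OF S] and T_sub = YZ.closedin_subset_points[OF T]
  note [measurable] = XY.coupling_measurable[OF \<pi>] YZ.coupling_measurable[OF \<rho>]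
    XY.closedin_coupling_sets[OF \<pi> S] YZ.closedin_coupling_sets[OF \<rho> T]
  obtain cell :: "'b \<Rightarrow> nat" where cell [measurable]: "cell \<in> measurable (law Y) (count_space UNIV)"
    and cell_dist: "\<And>x y. x \<in> points Y \<Longrightarrow> y \<in> points Y \<Longrightarrow> cell x = cell y \<Longrightarrow> feature_dist Y x y \<le> r"
    using XY.Y.countable_small_cells[OF r] by metis
  \<comment> \<open>Both label laws are images of the common marginal \<open>law Y\<close>.\<close>
  have "distr \<pi> (count_space UNIV) (\<lambda>p. cell (snd p)) = distr (distr \<pi> (law Y) snd) (count_space UNIV) cell"
    by (subst distr_distr) (auto simp: comp_def)
  also have "\<dots> = distr (distr \<rho> (law Y) fst) (count_space UNIV) cell"
    using \<pi> \<rho> by (simp add: XY.couplings_iff YZ.couplings_iff)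
  also have "\<dots> = distr \<rho> (count_space UNIV) (\<lambda>q. cell (fst q))"
    by (subst distr_distr) (auto simp: comp_def)
  finally have same_law: "distr \<pi> (count_space UNIV) (\<lambda>p. cell (snd p))
      = distr \<rho> (count_space UNIV) (\<lambda>q. cell (fst q))" .
  have labels: "(\<lambda>p. cell (snd p)) \<in> measurable \<pi> (count_space UNIV)"
      "(\<lambda>q. cell (fst q)) \<in> measurable \<rho> (count_space UNIV)"
    by measurable
  have prob: "prob_space \<pi>" "prob_space \<rho>"
    using \<pi> \<rho> by (auto simp: XY.couplings_iff YZ.couplings_iff)
  obtain \<sigma> where \<sigma> [measurable_cong]: "sets \<sigma> = sets (\<pi> \<Otimes>\<^sub>M \<rho>)"
    and \<sigma>_marg: "distr \<sigma> \<pi> fst = \<pi>" "distr \<sigma> \<rho> snd = \<rho>"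
    and \<sigma>_cell: "AE z in \<sigma>. cell (snd (fst z)) = cell (fst (snd z))"
    by (rule countable_gluing[OF prob labels same_law]) (rule that)
  have \<sigma>_meas [measurable]: "fst \<in> measurable \<sigma> \<pi>" "snd \<in> measurable \<sigma> \<rho>"
    by measurable
  interpret \<sigma>: prob_space \<sigma>
    using prob(1) \<sigma>_marg(1) prob_space_distrD[OF \<sigma>_meas(1)] by simp
  define h where "h z = (fst (fst z), snd (snd z))" for z :: "('a \<times> 'b) \<times> ('b \<times> 'c)"
  have h [measurable]: "h \<in> measurable \<sigma> (law X \<Otimes>\<^sub>M law Z)"
    unfolding h_def by measurable
  have h_coupling: "distr \<sigma> (law X \<Otimes>\<^sub>M law Z) h \<in> couplings X Z"
  proof -
    have "distr (distr \<sigma> (law X \<Otimes>\<^sub>M law Z) h) (law X) fst = distr (distr \<sigma> \<pi> fst) (law X) fst"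
      by (subst (1 2) distr_distr) (auto simp: comp_def h_def)
    moreover have "distr (distr \<sigma> (law X \<Otimes>\<^sub>M law Z) h) (law Z) snd = distr (distr \<sigma> \<rho> snd) (law Z) snd"
      by (subst (1 2) distr_distr) (auto simp: comp_def h_def)
    ultimately show ?thesis
      using \<pi> \<rho> \<sigma>_marg
      by (simp add: XZ.couplings_iff XY.couplings_iff YZ.couplings_iff \<sigma>.prob_space_distr)
  qed
  \<comment> \<open>\<open>T\<close> thickened by \<open>r\<close> in its first coordinate, so that
    composing it with \<open>S\<close> absorbs the discrepancy of the two middle points.\<close>
  let ?T' = "{(y, z). y \<in> points Y \<and> (\<exists>y'. (y', z) \<in> T \<and> feature_dist Y y y' \<le> r)}"
  have T'_sub: "?T' \<subseteq> points Y \<times> points Z"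
    using T_sub by auto
  have "features_close Y Z ?T' (d + 2 * r)"
  proof (rule YZ.features_close_perturb[OF T_close T_sub T'_sub])
    fix a b assume "(a, b) \<in> ?T'"
    then obtain y' where y': "(y', b) \<in> T" "feature_dist Y a y' \<le> r"
      by auto
    moreover have "feature_dist Z b b \<le> r"
      using y'(1) T_sub r by auto
    ultimately show "\<exists>(x, y)\<in>T. feature_dist Y a x \<le> r \<and> feature_dist Z b y \<le> r"
      by (intro bexI[of _ "(y', b)"]) auto
  qed
  then have close: "features_close X Z (S O ?T') (c + (d + 2 * r))"
    by (rule features_close_relcomp[OF S_close])
  have "box_distance X Z \<le> ennreal (2 * (c + (d + 2 * r)))"
  proof (rule XZ.box_distance_leI[OF h_coupling _ close])
    show "S O ?T' \<subseteq> points X \<times> points Z"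
      using S_sub T'_sub by blast
    fix V assume V: "closedin XZ.pair_topology V" "S O ?T' \<subseteq> V"
    have V_sets [measurable]: "V \<in> sets (law X \<Otimes>\<^sub>M law Z)"
      using closedin_sets[OF XZ.sets_pair_law V(1)] .
    let ?A = "fst -` S \<inter> space \<sigma>" and ?B = "snd -` T \<inter> space \<sigma>"
    have "measure \<sigma> ?A = measure \<pi> S" "measure \<sigma> ?B = measure \<rho> T"
      using \<sigma>_marg by (metis measure_distr \<sigma>_meas XY.closedin_coupling_sets[OF \<pi> S]
          YZ.closedin_coupling_sets[OF \<rho> T])+
    then have "measure \<sigma> (space \<sigma> - ?A) \<le> 2 * c" "measure \<sigma> (space \<sigma> - ?B) \<le> 2 * d"
      using \<pi>_mass \<rho>_mass by (simp_all add: \<sigma>.prob_compl)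
    \<comment> \<open>When the labels agree, membership in both \<open>S\<close> and
      \<open>T\<close> forces \<open>h z\<close> into \<open>S O ?T'\<close>. Hence the lost masses
      at most add up.\<close>
    moreover have "measure \<sigma> (space \<sigma> - h -` V) \<le> measure \<sigma> ((space \<sigma> - ?A) \<union> (space \<sigma> - ?B))"
    proof (rule \<sigma>.finite_measure_mono_AE)
      show "AE z in \<sigma>. z \<in> space \<sigma> - h -` V \<longrightarrow> z \<in> (space \<sigma> - ?A) \<union> (space \<sigma> - ?B)"
        using \<sigma>_cell
      proof eventually_elim
        fix z :: "('a \<times> 'b) \<times> ('b \<times> 'c)"
        assume z: "cell (snd (fst z)) = cell (fst (snd z))"
        have "h z \<in> V" if "fst z \<in> S" "snd z \<in> T"
        proof -
          have "snd (fst z) \<in> points Y" "fst (snd z) \<in> points Y"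
            using that S_sub T_sub by (auto simp: mem_Times_iff)
          then have "(snd (fst z), snd (snd z)) \<in> ?T'"
            using that(2) cell_dist[OF _ _ z] by (auto intro!: exI[of _ "fst (snd z)"])
          then have "h z \<in> S O ?T'"
            using that(1) unfolding h_def by (intro relcompI[of _ "snd (fst z)"]) auto
          then show ?thesis
            by (rule subsetD[OF V(2)])
        qed
        then show "z \<in> space \<sigma> - h -` V \<longrightarrow> z \<in> (space \<sigma> - ?A) \<union> (space \<sigma> - ?B)"
          by auto
      qed
    qed measurable
    moreover have "\<dots> \<le> measure \<sigma> (space \<sigma> - ?A) + measure \<sigma> (space \<sigma> - ?B)"
      by (rule measure_Un_le) measurable
    moreover have "measure \<sigma> (space \<sigma> - h -` V) = 1 - measure \<sigma> (h -` V \<inter> space \<sigma>)"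
      by (subst \<sigma>.prob_compl[symmetric]) (auto intro!: arg_cong[where f = "measure \<sigma>"] measurable_sets[OF h])
    moreover have "measure (distr \<sigma> (law X \<Otimes>\<^sub>M law Z) h) V = measure \<sigma> (h -` V \<inter> space \<sigma>)"
      by (rule measure_distr) measurable
    ultimately show "1 - 2 * (c + (d + 2 * r)) \<le> measure (distr \<sigma> (law X \<Otimes>\<^sub>M law Z) h) V"
      using r by simp
  qed (use pos r in auto)
  then show ?thesis
    by (simp add: add.assoc)
qed

lemma box_distance_triangle:
  assumes "geometric_data_set X" "geometric_data_set Y" "geometric_data_set Z"
  shows "box_distance X Z \<le> box_distance X Y + box_distance Y Z"
proof (rule ennreal_le_epsilon)
  interpret XY: data_pair X Y using assms by unfold_locales
  interpret YZ: data_pair Y Z using assms by unfold_locales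
  fix e :: real assume e: "0 < e"
  define a b where "a = enn2real (box_distance X Y)" and "b = enn2real (box_distance Y Z)"
  have nonneg: "0 \<le> a" "0 \<le> b"
    by (simp_all add: a_def b_def)
  have ab: "box_distance X Y = ennreal a" "box_distance Y Z = ennreal b"
    using XY.box_distance_le_1 YZ.box_distance_le_1 unfolding a_def b_def
    by (metis ennreal_enn2real ennreal_one_less_top order_le_less_trans)+
  \<comment> \<open>Two summands \<open>e / 4\<close> make the hypotheses of the gluing strict, and
    the cells contribute \<open>4 * (e / 8)\<close>; together this is \<open>e\<close>.\<close>
  have "box_distance X Z \<le> ennreal (2 * ((a + e / 4) / 2 + (b + e / 4) / 2 + 2 * (e / 8)))"
    by (rule box_distance_glue[OF assms]) (use e nonneg in \<open>auto simp: ab ennreal_less_iff\<close>)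
  also have "\<dots> \<le> ennreal (a + b + e)"
    by (rule ennreal_leI) (use e in \<open>simp add: field_simps\<close>)
  also have "\<dots> = box_distance X Y + box_distance Y Z + ennreal e"
    using e nonneg by (simp add: ab ennreal_plus)
  finally show "box_distance X Z \<le> box_distance X Y + box_distance Y Z + ennreal e" .
qed

subsection \<open>Isomorphisms as approximate matchings of features\<close>

lemma (in geometric_data) features_subset_Lip1: "features X \<subseteq> Lip1 X"
  using geometric feature_Lipschitz by (auto simp: geometric_data_set_def Lip1_def)

text \<open>Basic neighbourhoods for pointwise convergence constrain finitely many coordinates.
  Restricting to \<open>Lip1 X\<close> only adds membership of \<open>f\<close>, because the
  features already lie there.\<close>

lemma (in geometric_data) features_closure_iff:
  "f \<in> features_closure X \<longleftrightarrow> f \<in> Lip1 X \<and>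
     (\<forall>A e. finite A \<and> A \<subseteq> points X \<and> 0 < e \<longrightarrow> (\<exists>g\<in>features X. \<forall>a\<in>A. \<bar>f a - g a\<bar> \<le> e))"
  (is "?L \<longleftrightarrow> f \<in> Lip1 X \<and> ?R")
proof -
  let ?P = "product_topology (\<lambda>_. euclideanreal) (points X)"
  have Lip1_ext: "Lip1 X \<subseteq> topspace ?P"
    by (auto simp: Lip1_def extensional_def)
  have "?L \<longleftrightarrow> f \<in> Lip1 X \<and>
      (\<forall>T. f \<in> T \<and> (\<exists>W. openin ?P W \<and> T = W \<inter> Lip1 X) \<longrightarrow> (\<exists>g\<in>features X. g \<in> T))"
    unfolding features_closure_def in_closure_of openin_subtopology topspace_subtopology
      Int_absorb1[OF Lip1_ext] by (simp only: Bex_def)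
  also have "\<dots> \<longleftrightarrow> f \<in> Lip1 X \<and> (\<forall>W. openin ?P W \<and> f \<in> W \<longrightarrow> (\<exists>g\<in>features X. g \<in> W))"
  proof (rule conj_cong[OF refl], intro iffI allI impI)
    fix W assume f: "f \<in> Lip1 X" and W: "openin ?P W \<and> f \<in> W"
      and "\<forall>T. f \<in> T \<and> (\<exists>W. openin ?P W \<and> T = W \<inter> Lip1 X) \<longrightarrow> (\<exists>g\<in>features X. g \<in> T)"
    then have "\<exists>g\<in>features X. g \<in> W \<inter> Lip1 X"
      by (elim allE[of _ "W \<inter> Lip1 X"] impE) auto
    then show "\<exists>g\<in>features X. g \<in> W"
      by auto
  next
    fix T assume R: "\<forall>W. openin ?P W \<and> f \<in> W \<longrightarrow> (\<exists>g\<in>features X. g \<in> W)"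
      and "f \<in> T \<and> (\<exists>W. openin ?P W \<and> T = W \<inter> Lip1 X)"
    then obtain W where W: "openin ?P W" "f \<in> W" "T = W \<inter> Lip1 X"
      by auto
    then obtain g where "g \<in> features X" "g \<in> W"
      using R by meson
    then show "\<exists>g\<in>features X. g \<in> T"
      using W(3) features_subset_Lip1 by (intro bexI[of _ g]) auto
  qed
  finally have L: "?L \<longleftrightarrow> f \<in> Lip1 X \<and>
      (\<forall>W. openin ?P W \<and> f \<in> W \<longrightarrow> (\<exists>g\<in>features X. g \<in> W))" .
  have fwd: "?R" if f: "f \<in> Lip1 X" and W: "\<And>W. openin ?P W \<Longrightarrow> f \<in> W \<Longrightarrow> \<exists>g\<in>features X. g \<in> W"
  proof (intro allI impI)
    fix A and e :: real assume A: "finite A \<and> A \<subseteq> points X \<and> 0 < e"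
    define U where "U i = (if i \<in> A then ball (f i) e else UNIV)" for i
    have "finite {i \<in> points X. U i \<noteq> UNIV}"
      by (rule finite_subset[of _ A]) (use A in \<open>auto simp: U_def split: if_splits\<close>)
    then have "openin ?P (Pi\<^sub>E (points X) U)"
      by (subst openin_PiE_gen) (auto simp: U_def)
    moreover have "f \<in> Pi\<^sub>E (points X) U"
      using f A by (auto simp: U_def Lip1_def PiE_def)
    ultimately obtain g where g: "g \<in> features X" "g \<in> Pi\<^sub>E (points X) U"
      using W by meson
    have "\<bar>f a - g a\<bar> \<le> e" if a: "a \<in> A" for a
    proof -
      have "g a \<in> U a"
        using g(2) a A by (auto simp: PiE_def)
      then show ?thesis
        using a by (simp add: U_def dist_real_def)
    qed
    then show "\<exists>g\<in>features X. \<forall>a\<in>A. \<bar>f a - g a\<bar> \<le> e"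
      using g(1) by blast
  qed
  have bwd: "\<exists>g\<in>features X. g \<in> W" if R: ?R and W: "openin ?P W" "f \<in> W" for W
  proof -
    obtain U where U: "finite {i \<in> points X. U i \<noteq> UNIV}" "\<And>i. i \<in> points X \<Longrightarrow> open (U i)"
        "f \<in> Pi\<^sub>E (points X) U" "Pi\<^sub>E (points X) U \<subseteq> W"
      using W by (auto simp: openin_product_topology_alt)
    let ?A = "{i \<in> points X. U i \<noteq> UNIV}"
    have "\<exists>e>0. ball (f i) e \<subseteq> U i" if i: "i \<in> ?A" for i
      using U(2)[of i] U(3) i by (auto simp: open_contains_ball PiE_def)
    then obtain e where e: "\<And>i. i \<in> ?A \<Longrightarrow> 0 < e i \<and> ball (f i) (e i) \<subseteq> U i"
      by metis
    \<comment> \<open>The inserted 1 keeps the minimum meaningful when no coordinate is constrained;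
      halving it below makes a closed tolerance fit inside the open balls.\<close>
    let ?E = "insert 1 (e ` ?A)"
    have fin: "finite ?E"
      using U(1) by simp
    define m where "m = Min ?E / 2"
    have "0 < Min ?E"
      using fin e by (subst Min_gr_iff) auto
    then have m: "0 < m" "m < Min ?E"
      by (simp_all add: m_def)
    have m_less: "m < e i" if "i \<in> ?A" for i
      using m(2) Min_le[OF fin, of "e i"] that by simp
    obtain g where g: "g \<in> features X" "\<forall>a\<in>?A. \<bar>f a - g a\<bar> \<le> m"
      using R U(1) m(1) by (metis (no_types, lifting) mem_Collect_eq subsetI)
    have "g i \<in> U i" if i: "i \<in> points X" for i
    proof (cases "i \<in> ?A")
      case True
      then have "g i \<in> ball (f i) (e i)"
        using g(2) m_less[OF True] by (auto simp: dist_real_def)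
      then show ?thesis
        using e[OF True] by blast
    qed (use i in simp)
    moreover have "g \<in> extensional (points X)"
      using g(1) features_subset_Lip1 by (auto simp: Lip1_def)
    ultimately have "g \<in> Pi\<^sub>E (points X) U"
      by (simp add: PiE_def)
    then show ?thesis
      using g(1) by (intro bexI[of _ g] subsetD[OF U(4)])
  qed
  show ?thesis
    unfolding L
  proof (intro conj_cong[OF refl] iffI)
    assume f: "f \<in> Lip1 X"
      and W: "\<forall>W. openin ?P W \<and> f \<in> W \<longrightarrow> (\<exists>g\<in>features X. g \<in> W)"
    show ?R
      by (rule fwd[OF f]) (use W in simp)
  next
    assume ?R
    then show "\<forall>W. openin ?P W \<and> f \<in> W \<longrightarrow> (\<exists>g\<in>features X. g \<in> W)"
      using bwd[OF \<open>?R\<close>] by simp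
  qed
qed

lemma (in geometric_data) features_subset_closure: "features X \<subseteq> features_closure X"
proof
  fix f assume f: "f \<in> features X"
  then have "f \<in> Lip1 X"
    using features_subset_Lip1 by blast
  moreover have "\<exists>g\<in>features X. \<forall>a\<in>A. \<bar>f a - g a\<bar> \<le> e" if "0 < e" for A and e :: real
    using f that by (intro bexI[of _ f]) auto
  ultimately show "f \<in> features_closure X"
    by (simp add: features_closure_iff)
qed

text \<open>Read \<open>P e z\<close> as "\<open>z\<close> lies within \<open>e\<close> of an ideal
  point". Mutual consistency makes approximations of tolerance \<open>1 / (n + 1)\<close> Cauchy,
  and their limit realises the ideal point. It serves to find preimages under an isometry and to
  extend a map from a dense sequence.\<close>

lemma (in Metric_space) mcomplete_approximation:
  assumes "mcomplete"
    and ex: "\<And>e. 0 < e \<Longrightarrow> \<exists>z\<in>M. P e z"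
    and near: "\<And>e e' z z'. z \<in> M \<Longrightarrow> z' \<in> M \<Longrightarrow> P e z \<Longrightarrow> P e' z' \<Longrightarrow> d z z' \<le> e + e'"
  obtains l where "l \<in> M" "\<And>e z. z \<in> M \<Longrightarrow> P e z \<Longrightarrow> d l z \<le> e"
proof -
  have "\<forall>n. \<exists>z\<in>M. P (1 / real (Suc n)) z"
    using ex by simp
  then obtain z where z: "\<And>n. z n \<in> M" "\<And>n. P (1 / real (Suc n)) (z n)"
    by metis
  have "MCauchy z"
    unfolding MCauchy_def
  proof (intro conjI allI impI)
    show "range z \<subseteq> M"
      using z(1) by auto
    fix e :: real assume "0 < e"
    then obtain N where N: "1 / real (Suc N) < e / 2"
      by (metis half_gt_zero nat_approx_posE)
    have "d (z n) (z n') < e" if "N \<le> n" "N \<le> n'" for n n'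
    proof -
      have "1 / real (Suc n) \<le> 1 / real (Suc N)" "1 / real (Suc n') \<le> 1 / real (Suc N)"
        using that by (simp_all add: frac_le)
      then show ?thesis
        using near[OF z(1) z(1) z(2) z(2), of n n'] N by linarith
    qed
    then show "\<exists>N. \<forall>n n'. N \<le> n \<longrightarrow> N \<le> n' \<longrightarrow> d (z n) (z n') < e"
      by blast
  qed
  then obtain l where l: "limitin mtopology z l sequentially"
    using \<open>mcomplete\<close> unfolding mcomplete_def by blast
  show ?thesis
  proof
    show lM: "l \<in> M"
      using l by (rule limitin_mspace)
    fix e w assume w: "w \<in> M" "P e w"
    show "d l w \<le> e"
    proof (rule field_le_epsilon)
      fix \<epsilon> :: real assume \<epsilon>: "0 < \<epsilon>"
      obtain N where N: "1 / real (Suc N) < \<epsilon> / 2"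
        using \<epsilon> by (metis half_gt_zero nat_approx_posE)
      obtain N' where N': "\<And>n. N' \<le> n \<Longrightarrow> d (z n) l < \<epsilon> / 2"
        using l \<epsilon> unfolding limit_metric_sequentially by (meson half_gt_zero)
      let ?n = "max N N'"
      have "1 / real (Suc ?n) \<le> 1 / real (Suc N)"
        by (simp add: frac_le)
      moreover have "d (z ?n) l < \<epsilon> / 2"
        by (rule N') simp
      moreover have "d (z ?n) w \<le> 1 / real (Suc ?n) + e"
        using near[OF z(1) w(1) z(2) w(2)] .
      moreover have "d l w \<le> d (z ?n) l + d (z ?n) w"
        using triangle''[OF lM z(1) w(1)] by simp
      ultimately show "d l w \<le> e + \<epsilon>"
        using N by linarith
    qed
  qed
qed

text \<open>Encodes that the features of \<open>X\<close> and those of \<open>Y\<close> composed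
  with \<phi> have the same pointwise closure: pointwise approximation is tested on finite sets. In
  this form, composition and inversion reduce to operations on relations.\<close>

definition feature_matching :: "'a data_set \<Rightarrow> 'b data_set \<Rightarrow> ('a \<Rightarrow> 'b) \<Rightarrow> bool" where
  "feature_matching X Y \<phi> \<longleftrightarrow>
     (\<forall>A e. finite A \<and> A \<subseteq> points X \<and> 0 < e \<longrightarrow> features_close X Y ((\<lambda>a. (a, \<phi> a)) ` A) e)"

definition data_isomorphism :: "'a data_set \<Rightarrow> 'b data_set \<Rightarrow> ('a \<Rightarrow> 'b) \<Rightarrow> bool" where
  "data_isomorphism X Y \<phi> \<longleftrightarrow>
     \<phi> \<in> measurable (law X) (law Y) \<and> distr (law X) (law Y) \<phi> = law Y \<and> feature_matching X Y \<phi>"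

context data_pair
begin

text \<open>The case of two points in \<open>features_close_dist\<close>, with the tolerance tending
  to 0.\<close>

lemma feature_matching_isometry:
  assumes \<phi>: "feature_matching X Y \<phi>" "\<phi> \<in> points X \<rightarrow> points Y"
    and ab: "a \<in> points X" "b \<in> points X"
  shows "feature_dist Y (\<phi> a) (\<phi> b) = feature_dist X a b"
proof -
  have "\<bar>feature_dist X a b - feature_dist Y (\<phi> a) (\<phi> b)\<bar> \<le> 0 + e" if "0 < e" for e
  proof -
    have "features_close X Y ((\<lambda>a. (a, \<phi> a)) ` {a, b}) (e / 2)"
      using \<phi>(1) ab that unfolding feature_matching_def
      by (metis empty_subsetI finite.emptyI finite.insertI half_gt_zero insert_subset)
    from features_close_dist[OF this] show ?thesis
      using \<phi>(2) ab by (auto simp: Pi_iff)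
  qed
  then have "\<bar>feature_dist X a b - feature_dist Y (\<phi> a) (\<phi> b)\<bar> \<le> 0"
    by (rule field_le_epsilon)
  then show ?thesis
    by simp
qed

lemma isometry_measurable:
  assumes \<phi>: "\<phi> \<in> points X \<rightarrow> points Y"
    and iso: "\<And>a b. a \<in> points X \<Longrightarrow> b \<in> points X \<Longrightarrow> feature_dist Y (\<phi> a) (\<phi> b) = feature_dist X a b"
  shows "\<phi> \<in> measurable (law X) (law Y)"
proof (rule measurable_continuous_map[OF X.sets_law Y.sets_law])
  show "continuous_map (data_topology X) (data_topology Y) \<phi>"
    unfolding Y.data_topology_eq Y.continuous_map_to_metric
  proof (intro ballI allI impI)
    fix x and e :: real assume "x \<in> topspace (data_topology X)" "0 < e"
    then show "\<exists>U. openin (data_topology X) U \<and> x \<in> U \<and> (\<forall>y\<in>U. \<phi> y \<in> Y.mball (\<phi> x) e)"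
      using \<phi> iso by (intro exI[of _ "X.mball x e"]) (auto simp: X.data_topology_eq Pi_iff)
  qed
qed

text \<open>Full support of \<open>law Y\<close> gives every ball around \<open>y\<close> a nonempty
  preimage. As \<phi> is isometric, these approximate preimages are consistent, and completeness of
  \<open>X\<close> turns them into a preimage.\<close>

lemma isomorphism_surj:
  assumes \<phi>: "\<phi> \<in> measurable (law X) (law Y)" "distr (law X) (law Y) \<phi> = law Y"
    and iso: "\<And>a b. a \<in> points X \<Longrightarrow> b \<in> points X \<Longrightarrow> feature_dist Y (\<phi> a) (\<phi> b) = feature_dist X a b"
  shows "\<phi> ` points X = points Y"
proof
  have \<phi>_pts: "\<And>a. a \<in> points X \<Longrightarrow> \<phi> a \<in> points Y"
    using measurable_space[OF \<phi>(1)] by simp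
  then show "\<phi> ` points X \<subseteq> points Y"
    by blast
  show "points Y \<subseteq> \<phi> ` points X"
  proof
    fix y assume y: "y \<in> points Y"
    obtain x where x: "x \<in> points X"
      "\<And>e z. z \<in> points X \<Longrightarrow> feature_dist Y (\<phi> z) y < e \<Longrightarrow> feature_dist X x z \<le> e"
    proof (rule X.mcomplete_approximation[OF X.complete, where P = "\<lambda>e z. feature_dist Y (\<phi> z) y < e"])
      fix e :: real assume e: "0 < e"
      have "0 < measure (distr (law X) (law Y) \<phi>) (Y.mball y e)"
        using Y.measure_mball_pos[OF y e] \<phi>(2) by simp
      then have "0 < measure (law X) (\<phi> -` Y.mball y e \<inter> space (law X))"
        using measure_distr[OF \<phi>(1) Y.mball_sets] by simp
      then have "\<phi> -` Y.mball y e \<inter> points X \<noteq> {}"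
        by auto
      then show "\<exists>z\<in>points X. feature_dist Y (\<phi> z) y < e"
        using Y.commute[of y] by auto
    next
      fix e e' z z'
      assume "z \<in> points X" "z' \<in> points X" "feature_dist Y (\<phi> z) y < e" "feature_dist Y (\<phi> z') y < e'"
      then show "feature_dist X z z' \<le> e + e'"
        using Y.triangle'[OF \<phi>_pts y \<phi>_pts, of z z'] iso[of z z'] by linarith
    qed (rule that)
    have "feature_dist Y (\<phi> x) y \<le> 0 + e" if e: "0 < e" for e
    proof -
      have "0 < measure (distr (law X) (law Y) \<phi>) (Y.mball y (e / 2))"
        using Y.measure_mball_pos[OF y] \<phi>(2) e by simp
      then have "0 < measure (law X) (\<phi> -` Y.mball y (e / 2) \<inter> space (law X))"
        using measure_distr[OF \<phi>(1) Y.mball_sets] by simp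
      then have "\<phi> -` Y.mball y (e / 2) \<inter> points X \<noteq> {}"
        by auto
      then obtain z where z: "z \<in> points X" "feature_dist Y (\<phi> z) y < e / 2"
        using Y.commute[of y] by auto
      have "feature_dist Y (\<phi> x) y \<le> feature_dist Y (\<phi> x) (\<phi> z) + feature_dist Y (\<phi> z) y"
        using x(1) z(1) y \<phi>_pts by (intro Y.triangle) auto
      then show ?thesis
        using x(2)[OF z] iso[OF x(1) z(1)] z(2) by linarith
    qed
    then have "feature_dist Y (\<phi> x) y \<le> 0"
      by (rule field_le_epsilon)
    then have "\<phi> x = y"
      using Y.zero[OF \<phi>_pts[OF x(1)] y] Y.nonneg[of "\<phi> x" y] by linarith
    then show "y \<in> \<phi> ` points X"
      using x(1) by blast
  qed
qed


lemma data_isomorphism_points: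
  assumes "data_isomorphism X Y \<phi>"
  shows "\<phi> \<in> points X \<rightarrow> points Y"
  using assms measurable_space[of \<phi> "law X" "law Y"] by (auto simp: data_isomorphism_def)

lemma data_isomorphism_dist:
  assumes "data_isomorphism X Y \<phi>" "a \<in> points X" "b \<in> points X"
  shows "feature_dist Y (\<phi> a) (\<phi> b) = feature_dist X a b"
  using assms feature_matching_isometry data_isomorphism_points
  by (simp add: data_isomorphism_def)

lemma data_isomorphism_surj:
  assumes "data_isomorphism X Y \<phi>"
  shows "\<phi> ` points X = points Y"
  using assms by (intro isomorphism_surj data_isomorphism_dist) (auto simp: data_isomorphism_def)

lemma data_isomorphism_inj:
  assumes "data_isomorphism X Y \<phi>"
  shows "inj_on \<phi> (points X)"
proof (rule inj_onI)
  fix a b assume ab: "a \<in> points X" "b \<in> points X" "\<phi> a = \<phi> b"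
  have "\<phi> b \<in> points Y"
    using data_isomorphism_points[OF assms] ab by auto
  then have "feature_dist X a b = 0"
    using data_isomorphism_dist[OF assms ab(1,2)] ab(3) by simp
  then show "a = b"
    using ab by simp
qed

lemma data_isomorphism_approx:
  assumes \<phi>: "data_isomorphism X Y \<phi>" and A: "finite A" "A \<subseteq> points X" "0 < e"
  shows "f \<in> features X \<Longrightarrow> \<exists>g\<in>features Y. \<forall>a\<in>A. \<bar>f a - g (\<phi> a)\<bar> \<le> e"
    and "g \<in> features Y \<Longrightarrow> \<exists>f\<in>features X. \<forall>a\<in>A. \<bar>f a - g (\<phi> a)\<bar> \<le> e"
proof -
  have "features_close X Y ((\<lambda>a. (a, \<phi> a)) ` A) e"
    using assms by (simp add: data_isomorphism_def feature_matching_def)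
  then show "f \<in> features X \<Longrightarrow> \<exists>g\<in>features Y. \<forall>a\<in>A. \<bar>f a - g (\<phi> a)\<bar> \<le> e"
    and "g \<in> features Y \<Longrightarrow> \<exists>f\<in>features X. \<forall>a\<in>A. \<bar>f a - g (\<phi> a)\<bar> \<le> e"
    by (simp_all add: features_close_def)
qed

text \<open>Being isometric and bijective, \<phi> has an isometric and hence measurable inverse.
  Feature matching passes to the converse of the graph.\<close>

lemma data_isomorphism_inverse:
  assumes \<phi>: "data_isomorphism X Y \<phi>"
  shows "data_isomorphism Y X (inv_into (points X) \<phi>)"
proof -
  interpret YX: data_pair Y X ..
  let ?\<psi> = "inv_into (points X) \<phi>"
  note inj = data_isomorphism_inj[OF \<phi>] and surj = data_isomorphism_surj[OF \<phi>]
  have \<phi>_meas: "\<phi> \<in> measurable (law X) (law Y)" and \<phi>_law: "distr (law X) (law Y) \<phi> = law Y"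
    using \<phi> by (auto simp: data_isomorphism_def)
  have \<psi>: "?\<psi> y \<in> points X" "\<phi> (?\<psi> y) = y" if "y \<in> points Y" for y
    using that surj by (auto intro: inv_into_into f_inv_into_f)
  have \<psi>_meas: "?\<psi> \<in> measurable (law Y) (law X)"
  proof (rule YX.isometry_measurable)
    fix a b assume "a \<in> points Y" "b \<in> points Y"
    then show "feature_dist X (?\<psi> a) (?\<psi> b) = feature_dist Y a b"
      using data_isomorphism_dist[OF \<phi> \<psi>(1) \<psi>(1), of a b] \<psi>(2) by simp
  qed (use \<psi> in auto)
  have "distr (law Y) (law X) ?\<psi> = distr (distr (law X) (law Y) \<phi>) (law X) ?\<psi>"
    by (simp add: \<phi>_law)
  also have "\<dots> = distr (law X) (law X) (?\<psi> \<circ> \<phi>)"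
    by (rule distr_distr[OF \<psi>_meas \<phi>_meas])
  also have "\<dots> = distr (law X) (law X) (\<lambda>x. x)"
    by (rule distr_cong) (use inj in auto)
  finally have \<psi>_law: "distr (law Y) (law X) ?\<psi> = law X"
    by simp
  have "feature_matching Y X ?\<psi>"
    unfolding feature_matching_def
  proof (intro allI impI)
    fix A and e :: real assume A: "finite A \<and> A \<subseteq> points Y \<and> 0 < e"
    then have "features_close X Y ((\<lambda>a. (a, \<phi> a)) ` ?\<psi> ` A) e"
      using \<phi> \<psi>(1) unfolding data_isomorphism_def feature_matching_def
      by (intro \<phi>[unfolded data_isomorphism_def feature_matching_def, THEN conjunct2, THEN conjunct2,
            rule_format]) auto
    moreover have "(\<lambda>a. (a, \<phi> a)) ` ?\<psi> ` A = ((\<lambda>a. (a, ?\<psi> a)) ` A)\<inverse>"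
      using \<psi>(2) A by force
    ultimately show "features_close Y X ((\<lambda>a. (a, ?\<psi> a)) ` A) e"
      using features_close_converse by force
  qed
  with \<psi>_meas \<psi>_law show ?thesis
    by (simp add: data_isomorphism_def)
qed

text \<open>On a finite set, \<open>g\<close> is first replaced by a genuine feature of
  \<open>Y\<close> and then by one of \<open>X\<close>, each time at cost \<open>e / 2\<close>.
  Applied to the inverse as well, this gives equality of the closures.\<close>

lemma data_isomorphism_compose_closure:
  assumes \<phi>: "data_isomorphism X Y \<phi>" and g: "g \<in> features_closure Y"
  shows "compose (points X) g \<phi> \<in> features_closure X"
  unfolding X.features_closure_iff
proof (intro conjI allI impI)
  note pts = data_isomorphism_points[OF \<phi>]
  have g_Lip: "g \<in> Lip1 Y"
    using g by (simp add: Y.features_closure_iff)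
  show "compose (points X) g \<phi> \<in> Lip1 X"
    unfolding Lip1_def
  proof (intro CollectI conjI ballI)
    fix a b assume ab: "a \<in> points X" "b \<in> points X"
    then have "\<bar>g (\<phi> a) - g (\<phi> b)\<bar> \<le> feature_dist Y (\<phi> a) (\<phi> b)"
      using g_Lip pts by (auto simp: Lip1_def)
    then show "\<bar>compose (points X) g \<phi> a - compose (points X) g \<phi> b\<bar> \<le> feature_dist X a b"
      using data_isomorphism_dist[OF \<phi> ab] ab by (simp add: compose_eq)
  qed (rule compose_extensional)
  fix A and e :: real assume A: "finite A \<and> A \<subseteq> points X \<and> 0 < e"
  then have "finite (\<phi> ` A)" "\<phi> ` A \<subseteq> points Y" "0 < e / 2"
    using pts by auto
  then obtain g' where g': "g' \<in> features Y" "\<forall>b\<in>\<phi> ` A. \<bar>g b - g' b\<bar> \<le> e / 2"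
    using g unfolding Y.features_closure_iff by meson
  obtain f where f: "f \<in> features X" "\<forall>a\<in>A. \<bar>f a - g' (\<phi> a)\<bar> \<le> e / 2"
    using data_isomorphism_approx(2)[OF \<phi> _ _ _ g'(1), of A "e / 2"] A by auto
  have "\<bar>compose (points X) g \<phi> a - f a\<bar> \<le> e" if a: "a \<in> A" for a
  proof -
    have "compose (points X) g \<phi> a = g (\<phi> a)"
      using a A by (intro compose_eq) auto
    moreover have "\<bar>g (\<phi> a) - g' (\<phi> a)\<bar> \<le> e / 2" "\<bar>f a - g' (\<phi> a)\<bar> \<le> e / 2"
      using a g'(2) f(2) by auto
    ultimately show ?thesis
      by linarith
  qed
  then show "\<exists>f\<in>features X. \<forall>a\<in>A. \<bar>compose (points X) g \<phi> a - f a\<bar> \<le> e"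
    using f(1) by blast
qed

text \<open>From closures to features, elements of a closure are approximated on finite sets. In the
  other direction the inverse isomorphism supplies the preimage \<open>f\<close> after
  \<open>?\<psi>\<close> of each \<open>f\<close> in the closure.\<close>

lemma isomorphic_data_sets_iff:
  "isomorphic_data_sets X Y \<longleftrightarrow> (\<exists>\<phi>. data_isomorphism X Y \<phi>)"
proof
  assume "isomorphic_data_sets X Y"
  then obtain \<phi> where \<phi>: "\<phi> \<in> measurable (law X) (law Y)" "distr (law X) (law Y) \<phi> = law Y"
    and closure: "(\<lambda>g. compose (points X) g \<phi>) ` features_closure Y = features_closure X"
    unfolding isomorphic_data_sets_def by metis
  have pts: "\<phi> \<in> points X \<rightarrow> points Y"
    using measurable_space[OF \<phi>(1)] by auto
  have "feature_matching X Y \<phi>"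
    unfolding feature_matching_def features_close_def
  proof (intro allI impI conjI ballI)
    fix A and e :: real and f assume A: "finite A \<and> A \<subseteq> points X \<and> 0 < e" and f: "f \<in> features X"
    have "f \<in> (\<lambda>g. compose (points X) g \<phi>) ` features_closure Y"
      unfolding closure using f by (rule subsetD[OF X.features_subset_closure])
    then obtain g where g: "g \<in> features_closure Y" "f = compose (points X) g \<phi>"
      by auto
    have "finite (\<phi> ` A)" "\<phi> ` A \<subseteq> points Y"
      using A pts by auto
    then obtain g' where g': "g' \<in> features Y" "\<forall>b\<in>\<phi> ` A. \<bar>g b - g' b\<bar> \<le> e"
      using g(1) A unfolding Y.features_closure_iff by meson
    have "f a = g (\<phi> a)" if "a \<in> A" for a
    proof -
      have "a \<in> points X"
        using that A by blast
      then show ?thesis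
        by (simp add: g(2) compose_eq)
    qed
    then show "\<exists>g\<in>features Y. \<forall>(x, y)\<in>(\<lambda>a. (a, \<phi> a)) ` A. \<bar>f x - g y\<bar> \<le> e"
      using g' by (intro bexI[of _ g']) auto
  next
    fix A and e :: real and g assume A: "finite A \<and> A \<subseteq> points X \<and> 0 < e" and g: "g \<in> features Y"
    have "compose (points X) g \<phi> \<in> features_closure X"
      unfolding closure[symmetric] by (rule imageI) (rule subsetD[OF Y.features_subset_closure g])
    then obtain f where f: "f \<in> features X" "\<forall>a\<in>A. \<bar>compose (points X) g \<phi> a - f a\<bar> \<le> e"
      using A unfolding X.features_closure_iff by meson
    have "compose (points X) g \<phi> a = g (\<phi> a)" if "a \<in> A" for a
    proof -
      have "a \<in> points X"
        using that A by blast
      then show ?thesis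
        by (simp add: compose_eq)
    qed
    then show "\<exists>f\<in>features X. \<forall>(x, y)\<in>(\<lambda>a. (a, \<phi> a)) ` A. \<bar>f x - g y\<bar> \<le> e"
      using f by (intro bexI[of _ f]) (auto simp: abs_minus_commute)
  qed
  then show "\<exists>\<phi>. data_isomorphism X Y \<phi>"
    using \<phi> by (auto simp: data_isomorphism_def)
next
  assume "\<exists>\<phi>. data_isomorphism X Y \<phi>"
  then obtain \<phi> where \<phi>: "data_isomorphism X Y \<phi>" ..
  interpret YX: data_pair Y X ..
  let ?\<psi> = "inv_into (points X) \<phi>"
  have \<psi>: "data_isomorphism Y X ?\<psi>"
    by (rule data_isomorphism_inverse[OF \<phi>])
  have "(\<lambda>g. compose (points X) g \<phi>) ` features_closure Y = features_closure X"
  proof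
    show "(\<lambda>g. compose (points X) g \<phi>) ` features_closure Y \<subseteq> features_closure X"
      using data_isomorphism_compose_closure[OF \<phi>] by blast
    show "features_closure X \<subseteq> (\<lambda>g. compose (points X) g \<phi>) ` features_closure Y"
    proof
      fix f assume f: "f \<in> features_closure X"
      have "compose (points X) (compose (points Y) f ?\<psi>) \<phi> a = f a" for a
      proof (cases "a \<in> points X")
        case True
        then have "\<phi> a \<in> points Y"
          using data_isomorphism_points[OF \<phi>] by auto
        then show ?thesis
          using True data_isomorphism_inj[OF \<phi>] by (simp add: compose_eq)
      next
        \<comment> \<open>Off the carrier both sides are \<open>undefined\<close>, since elements of
          the closure are extensional.\<close>
        case False
        then show ?thesis
          using f by (auto simp: X.features_closure_iff Lip1_def compose_def extensional_def)
      qed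
      then have "f = compose (points X) (compose (points Y) f ?\<psi>) \<phi>"
        by auto
      then show "f \<in> (\<lambda>g. compose (points X) g \<phi>) ` features_closure Y"
        using YX.data_isomorphism_compose_closure[OF \<psi> f] by (rule image_eqI)
    qed
  qed
  then show "isomorphic_data_sets X Y"
    using \<phi> unfolding isomorphic_data_sets_def data_isomorphism_def by blast
qed

end

lemma data_isomorphism_id: "data_isomorphism X X (\<lambda>x. x)"
  unfolding data_isomorphism_def feature_matching_def features_close_def
  by (auto intro: bexI[rotated])

lemma data_isomorphism_trans:
  assumes \<phi>: "data_isomorphism X Y \<phi>" and \<psi>: "data_isomorphism Y Z \<psi>"
    and "geometric_data_set X" "geometric_data_set Y" "geometric_data_set Z"
  shows "data_isomorphism X Z (\<psi> \<circ> \<phi>)"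
proof -
  interpret XY: data_pair X Y using assms by unfold_locales
  note meas = \<phi>[unfolded data_isomorphism_def, THEN conjunct1] \<psi>[unfolded data_isomorphism_def, THEN conjunct1]
  have "distr (law X) (law Z) (\<psi> \<circ> \<phi>) = distr (distr (law X) (law Y) \<phi>) (law Z) \<psi>"
    by (rule distr_distr[symmetric, OF meas(2,1)])
  also have "\<dots> = law Z"
    using \<phi> \<psi> by (simp add: data_isomorphism_def)
  finally have "distr (law X) (law Z) (\<psi> \<circ> \<phi>) = law Z" .
  moreover have "feature_matching X Z (\<psi> \<circ> \<phi>)"
    unfolding feature_matching_def
  proof (intro allI impI)
    fix A and e :: real assume A: "finite A \<and> A \<subseteq> points X \<and> 0 < e"
    have "features_close X Y ((\<lambda>a. (a, \<phi> a)) ` A) (e / 2)"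
      using \<phi> A by (simp add: data_isomorphism_def feature_matching_def)
    moreover have "features_close Y Z ((\<lambda>b. (b, \<psi> b)) ` \<phi> ` A) (e / 2)"
      using \<psi>[unfolded data_isomorphism_def feature_matching_def, THEN conjunct2, THEN conjunct2,
          rule_format, of "\<phi> ` A" "e / 2"] A XY.data_isomorphism_points[OF \<phi>]
      by auto
    ultimately have "features_close X Z (((\<lambda>a. (a, \<phi> a)) ` A) O ((\<lambda>b. (b, \<psi> b)) ` \<phi> ` A)) (e / 2 + e / 2)"
      by (rule features_close_relcomp)
    then show "features_close X Z ((\<lambda>a. (a, (\<psi> \<circ> \<phi>) a)) ` A) e"
      by (rule features_close_mono) auto
  qed
  ultimately show ?thesis
    using measurable_comp[OF meas] by (simp add: data_isomorphism_def)
qed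

subsection \<open>Vanishing box distance\<close>

context data_pair
begin

text \<open>The feature families agree only up to pointwise closure, so they are uniformly close only on
  a finite union of small balls, which still carries almost all of the mass.\<close>

lemma data_isomorphism_box_distance:
  assumes \<phi>: "data_isomorphism X Y \<phi>"
  shows "box_distance X Y = 0"
proof -
  have "box_distance X Y \<le> 0 + ennreal e" if e: "0 < e" for e
  proof -
    \<comment> \<open>Any \<open>r\<close> with \<open>r + 2 * r\<close> at most
      \<open>e / 2\<close> would do.\<close>
    define r where "r = e / 8"
    have r: "0 < r" "e = 8 * r"
      using e by (simp_all add: r_def)
    note pts = data_isomorphism_points[OF \<phi>]
    have \<phi>_meas [measurable]: "\<phi> \<in> measurable (law X) (law Y)"
      and \<phi>_law: "distr (law X) (law Y) \<phi> = law Y"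
      using \<phi> by (auto simp: data_isomorphism_def)
    have \<phi>_pts: "\<phi> a \<in> points Y" if "a \<in> points X" for a
      using pts that by auto
    obtain s :: "nat \<Rightarrow> 'a" where s: "\<And>k. s k \<in> points X"
      "\<And>x r. x \<in> points X \<Longrightarrow> 0 < r \<Longrightarrow> \<exists>k. feature_dist X (s k) x < r"
      by (rule X.dense_sequence) (rule that)
    obtain N :: nat where N: "1 - e < measure (law X) (\<Union>k<N. X.mball (s k) r)"
      using X.finite_balls_large_mass[OF s r(1) e] by metis
    let ?K = "\<Union>k<N. X.mball (s k) r"
    let ?h = "\<lambda>x. (x, \<phi> x)"
    have h [measurable]: "?h \<in> measurable (law X) (law X \<Otimes>\<^sub>M law Y)"
      by measurable
    let ?\<pi> = "distr (law X) (law X \<Otimes>\<^sub>M law Y) ?h"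
    have \<pi>: "?\<pi> \<in> couplings X Y"
      using \<phi>_law
      by (auto simp: couplings_iff distr_distr comp_def intro!: X.law.prob_space_distr)
    have "features_close X Y (?h ` s ` {..<N}) r"
      using \<phi>[unfolded data_isomorphism_def feature_matching_def, THEN conjunct2, THEN conjunct2,
          rule_format, of "s ` {..<N}" r] s(1) r(1) by blast
    \<comment> \<open>Closeness at the centres spreads to the balls, because \<phi> moves a point
      and its centre to points at the same distance.\<close>
    then have "features_close X Y (?h ` ?K) (r + 2 * r)"
    proof (rule features_close_perturb)
      fix a b assume "(a, b) \<in> ?h ` ?K"
      then obtain k where k: "k < N" "a \<in> points X" "feature_dist X (s k) a < r" "b = \<phi> a"
        by auto
      have "feature_dist Y b (\<phi> (s k)) = feature_dist X a (s k)"
        using data_isomorphism_dist[OF \<phi> k(2) s(1)] k(4) by simp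
      then show "\<exists>(x, y)\<in>?h ` s ` {..<N}. feature_dist X a x \<le> r \<and> feature_dist Y b y \<le> r"
        using k(1,3) X.commute[of a "s k"] by (intro bexI[of _ "?h (s k)"]) auto
    qed (use s(1) \<phi>_pts in auto)
    then have close: "features_close X Y (?h ` ?K) (e / 2)"
      by (rule features_close_mono) (use r in auto)
    have "box_distance X Y \<le> ennreal (2 * (e / 2))"
    proof (rule box_distance_leI[OF \<pi> _ close])
      show "?h ` ?K \<subseteq> points X \<times> points Y"
        using \<phi>_pts by auto
      fix T assume T: "closedin pair_topology T" "?h ` ?K \<subseteq> T"
      have T_sets: "T \<in> sets (law X \<Otimes>\<^sub>M law Y)"
        using closedin_sets[OF sets_pair_law T(1)] .
      have "measure (law X) ?K \<le> measure (law X) (?h -` T \<inter> space (law X))"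
        using T(2) measurable_sets[OF h T_sets] by (intro X.law.finite_measure_mono) auto
      also have "\<dots> = measure ?\<pi> T"
        by (rule measure_distr[OF h T_sets, symmetric])
      finally show "1 - 2 * (e / 2) \<le> measure ?\<pi> T"
        using N by simp
    qed (use e in simp)
    then show ?thesis
      by simp
  qed
  then have "box_distance X Y \<le> 0"
    by (rule ennreal_le_epsilon)
  then show ?thesis
    by simp
qed

end

section \<open>Finite nets from mass bounds, and comparison of measures on closed sets\<close>

context geometric_data
begin

text \<open>Balls of radius \<open>r / 2\<close> around \<open>r\<close>-separated points are
  disjoint, so a separated set has at most \<open>1 / c\<close> elements. One of maximal cardinality
  is a net.\<close>

lemma finite_net_of_mass:
  assumes T: "T \<subseteq> points X" and c: "0 < c"
    and mass: "\<And>t. t \<in> T \<Longrightarrow> c \<le> measure (law X) (mball t (r / 2))"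
  obtains K where "finite K" "K \<subseteq> T" "T \<subseteq> (\<Union>x\<in>K. mball x r)"
proof -
  define sep where "sep K \<longleftrightarrow> finite K \<and> K \<subseteq> T \<and> pairwise (\<lambda>x y. r \<le> feature_dist X x y) K" for K
  have card_le: "real (card K) * c \<le> 1" if K: "sep K" for K
  proof -
    have disj: "disjoint_family_on (\<lambda>t. mball t (r / 2)) K"
      unfolding disjoint_family_on_def
    proof (intro ballI impI)
      fix x y assume "x \<in> K" "y \<in> K" "x \<noteq> y"
      then have "r / 2 + r / 2 \<le> feature_dist X x y"
        using K by (auto simp: sep_def pairwise_def)
      then show "mball x (r / 2) \<inter> mball y (r / 2) = {}"
        using disjoint_mball by (simp add: disjnt_def)
    qed
    have "real (card K) * c = (\<Sum>t\<in>K. c)"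
      by simp
    also have "\<dots> \<le> (\<Sum>t\<in>K. measure (law X) (mball t (r / 2)))"
      using K mass by (intro sum_mono) (auto simp: sep_def)
    also have "\<dots> = measure (law X) (\<Union>t\<in>K. mball t (r / 2))"
      using K disj by (intro law.finite_measure_finite_Union[symmetric]) (auto simp: sep_def)
    also have "\<dots> \<le> 1"
      by (rule law.prob_le_1)
    finally show ?thesis .
  qed
  have bound: "card K < Suc (nat \<lfloor>1 / c\<rfloor>)" if "sep K" for K
  proof -
    have "real (card K) \<le> 1 / c"
      using card_le[OF that] c by (simp add: field_simps)
    then show ?thesis
      by (simp add: le_nat_floor less_Suc_eq_le)
  qed
  have "sep {}"
    by (simp add: sep_def)
  then obtain K where K: "sep K" "\<And>L. sep L \<Longrightarrow> card L \<le> card K"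
    using ex_has_greatest_nat[of sep "{}" card] bound by blast
  show ?thesis
  proof
    show "finite K" "K \<subseteq> T"
      using K(1) by (auto simp: sep_def)
    show "T \<subseteq> (\<Union>x\<in>K. mball x r)"
    proof
      fix t assume t: "t \<in> T"
      show "t \<in> (\<Union>x\<in>K. mball x r)"
      proof (rule ccontr)
        assume nt: "t \<notin> (\<Union>x\<in>K. mball x r)"
        have far: "r \<le> feature_dist X x t" "r \<le> feature_dist X t x" if "x \<in> K" for x
          using nt that t T K(1) commute[of t x] by (auto simp: sep_def not_less)
        \<comment> \<open>Positivity of \<open>r\<close> is extracted from the mass bound: a ball of
          positive mass is nonempty.\<close>
        have "mball t (r / 2) \<noteq> {}"
          using mass[OF t] c by auto
        then have "0 < r"
          using mball_eq_empty[of t "r / 2"] by (metis half_gt_zero_iff not_le)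
        then have "t \<notin> K"
          using far(1)[of t] subsetD[OF T t] by auto
        have "sep (insert t K)"
          using K(1) t far unfolding sep_def by (auto simp: pairwise_insert)
        then have "card (insert t K) \<le> card K"
          by (rule K(2))
        then show False
          using \<open>t \<notin> K\<close> K(1) by (simp add: sep_def)
      qed
    qed
  qed
qed

text \<open>The open neighbourhoods decrease to the closure of \<open>C\<close>, which is
  \<open>C\<close>. It is stated for a general \<nu> so that it also applies to image
  measures.\<close>

lemma Lim_measure_neighbourhoods:
  assumes \<nu>: "finite_measure \<nu>" "sets \<nu> = sets (law X)" and C: "closedin mtopology C"
  shows "(\<lambda>n. measure \<nu> (\<Union>c\<in>C. mball c (1 / real (Suc n)))) \<longlonglongrightarrow> measure \<nu> C"
proof -
  interpret \<nu>: finite_measure \<nu> by fact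
  let ?U = "\<lambda>n. \<Union>c\<in>C. mball c (1 / real (Suc n))"
  have "openin mtopology (?U n)" for n
    by (intro openin_Union) auto
  then have U: "range ?U \<subseteq> sets \<nu>"
    using openin_sets[OF sets_law] \<nu>(2) by (auto simp: data_topology_eq)
  have dec: "decseq ?U"
    unfolding decseq_def
  proof (intro allI impI UN_mono order_refl mball_subset_concentric)
    fix m n :: nat assume "m \<le> n"
    then show "1 / real (Suc n) \<le> 1 / real (Suc m)"
      by (simp add: frac_le)
  qed
  have "(\<Inter>n. ?U n) = C"
  proof
    show "C \<subseteq> (\<Inter>n. ?U n)"
      using closedin_subset[OF C] by fastforce
    show "(\<Inter>n. ?U n) \<subseteq> C"
    proof
      fix y assume y: "y \<in> (\<Inter>n. ?U n)"
      have "y \<in> mtopology closure_of C"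
        unfolding metric_closure_of
      proof (intro CollectI conjI allI impI)
        show "y \<in> points X"
          using y by auto
        fix r :: real assume "0 < r"
        then obtain n where n: "1 / real (Suc n) < r"
          by (metis nat_approx_posE)
        obtain c where "c \<in> C" "c \<in> points X" "y \<in> points X" "feature_dist X c y < 1 / real (Suc n)"
          using y by auto
        then show "\<exists>z\<in>C. z \<in> mball y r"
          using n commute[of y c] by (intro bexI[of _ c]) auto
      qed
      then show "y \<in> C"
        using C by (simp add: closure_of_closedin)
    qed
  qed
  then show ?thesis
    using \<nu>.finite_Lim_measure_decseq[OF U dec] by simp
qed

text \<open>The one-sided inequality on closed sets is reversed on open sets, and closed sets are
  decreasing limits of their open neighbourhoods.\<close>

lemma prob_eqI_closed_le:
  assumes "prob_space \<mu>" "prob_space \<nu>" and sets: "sets \<mu> = sets (law X)" "sets \<nu> = sets (law X)"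
    and le: "\<And>C. closedin mtopology C \<Longrightarrow> measure \<mu> C \<le> measure \<nu> C"
  shows "\<mu> = \<nu>"
proof -
  interpret \<mu>: prob_space \<mu> by fact
  interpret \<nu>: prob_space \<nu> by fact
  have space: "space \<mu> = points X" "space \<nu> = points X"
    using sets_eq_imp_space_eq sets space_law by metis+
  have compl: "measure \<mu> (points X - A) = 1 - measure \<mu> A"
      "measure \<nu> (points X - A) = 1 - measure \<nu> A" if "A \<in> sets (law X)" for A
    using \<mu>.prob_compl[of A] \<nu>.prob_compl[of A] that sets space by auto
  have open_sets: "U \<in> sets (law X)" if "openin mtopology U" for U
    using that openin_sets[OF sets_law] by (simp add: data_topology_eq)
  have open_ge: "measure \<nu> U \<le> measure \<mu> U" if U: "openin mtopology U" for U
  proof -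
    have "closedin mtopology (points X - U)"
      using U by (metis closedin_diff closedin_topspace topspace_mtopology)
    then show ?thesis
      using le[of "points X - U"] compl[OF open_sets[OF U]] by simp
  qed
  have closed_eq: "measure \<mu> C = measure \<nu> C" if C: "closedin mtopology C" for C
  proof (rule antisym[OF le[OF C]])
    have "measure \<nu> C \<le> measure \<mu> (\<Union>c\<in>C. mball c (1 / real (Suc n)))" for n
    proof -
      have U: "openin mtopology (\<Union>c\<in>C. mball c (1 / real (Suc n)))"
        by (intro openin_Union) auto
      have "C \<subseteq> (\<Union>c\<in>C. mball c (1 / real (Suc n)))"
        using closedin_subset[OF C] by fastforce
      then have "measure \<nu> C \<le> measure \<nu> (\<Union>c\<in>C. mball c (1 / real (Suc n)))"
        using open_sets[OF U] sets by (intro \<nu>.finite_measure_mono) auto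
      also have "\<dots> \<le> measure \<mu> (\<Union>c\<in>C. mball c (1 / real (Suc n)))"
        by (rule open_ge[OF U])
      finally show ?thesis .
    qed
    then show "measure \<nu> C \<le> measure \<mu> C"
      using Lim_measure_neighbourhoods[OF \<mu>.finite_measure_axioms sets(1) C]
      by (intro LIMSEQ_le_const) auto
  qed
  have open_eq: "measure \<mu> U = measure \<nu> U" if U: "openin mtopology U" for U
  proof -
    have "closedin mtopology (points X - U)"
      using U by (metis closedin_diff closedin_topspace topspace_mtopology)
    then show ?thesis
      using closed_eq[of "points X - U"] compl[OF open_sets[OF U]] by simp
  qed
  show ?thesis
  proof (rule measure_eqI_generator_eq[where E = "{U. openin mtopology U}" and \<Omega> = "points X"
        and A = "\<lambda>_. points X"])
    show "Int_stable {U. openin mtopology U}"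
      by (auto simp: Int_stable_def)
    show "{U. openin mtopology U} \<subseteq> Pow (points X)"
      using openin_subset by fastforce
    show "sets \<mu> = sigma_sets (points X) {U. openin mtopology U}"
      "sets \<nu> = sigma_sets (points X) {U. openin mtopology U}"
      using sets sets_law by (simp_all add: borel_sets_def data_topology_eq)
  qed (auto simp: \<mu>.emeasure_eq_measure \<nu>.emeasure_eq_measure open_eq)
qed

end


section \<open>From vanishing box distance to an isomorphism\<close>

text \<open>The data extracted from box distance 0, with a single error \<open>e n\<close> for mass
  and features. The bound \<open>e n < 1\<close> keeps every \<open>S n\<close> nonempty, so that
  partners can be chosen for all \<open>n\<close>.\<close>

locale box_approximation = data_pair X Y
  for X :: "'a data_set" and Y :: "'b data_set" +
  fixes \<pi> :: "nat \<Rightarrow> ('a \<times> 'b) measure" and S :: "nat \<Rightarrow> ('a \<times> 'b) set" and e :: "nat \<Rightarrow> real"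
  assumes coupling: "\<pi> n \<in> couplings X Y"
    and closed: "closedin pair_topology (S n)"
    and mass: "1 - e n < measure (\<pi> n) (S n)"
    and close: "features_close X Y (S n) (e n)"
    and e_less_1: "e n < 1"
    and e_lim: "e \<longlonglongrightarrow> 0"
begin

lemma S_points: "(x, y) \<in> S n \<Longrightarrow> x \<in> points X \<and> y \<in> points Y"
  using closedin_subset_points[OF closed] by blast

lemma e_eventually_less: "0 < c \<Longrightarrow> eventually (\<lambda>n. e n < c) sequentially"
  using e_lim by (rule order_tendstoD)

lemma S_nonempty: "S n \<noteq> {}"
  using mass[of n] e_less_1[of n] by auto

lemma S_dist:
  assumes "(x, y) \<in> S n" "(x', y') \<in> S n"
  shows "feature_dist Y y y' \<le> feature_dist X x x' + 2 * e n"
  using features_close_dist[OF close closedin_subset_points[OF closed] assms] by linarith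

lemma S_mass_le:
  assumes "A \<in> sets (law X)" "B \<in> sets (law Y)" "\<And>x y. (x, y) \<in> S n \<Longrightarrow> x \<in> A \<Longrightarrow> y \<in> B"
  shows "measure (law X) A \<le> measure (law Y) B + e n"
  by (rule coupling_mass_le[OF coupling closedin_coupling_sets[OF coupling closed]
        less_imp_le[OF mass] assms(1,2)]) (rule assms(3))

text \<open>A ball around \<open>a\<close> has positive mass by full support. If \<open>S n\<close>
  missed the strip over it, \<open>S_mass_le\<close> with an empty target would bound that mass by
  \<open>e n\<close>.\<close>

lemma eventually_S_near:
  assumes a: "a \<in> points X" and r: "0 < r"
  shows "eventually (\<lambda>n. \<exists>(x, y)\<in>S n. feature_dist X x a < r) sequentially"
  using e_eventually_less[OF X.measure_mball_pos[OF a r]]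
proof eventually_elim
  fix n assume n: "e n < measure (law X) (X.mball a r)"
  show "\<exists>(x, y)\<in>S n. feature_dist X x a < r"
  proof (rule ccontr)
    assume none: "\<not> (\<exists>(x, y)\<in>S n. feature_dist X x a < r)"
    have "measure (law X) (X.mball a r) \<le> measure (law Y) {} + e n"
    proof (rule S_mass_le)
      fix x y assume "(x, y) \<in> S n" "x \<in> X.mball a r"
      then show "y \<in> {}"
        using none X.commute[of a x] by auto
    qed auto
    then show False
      using n by simp
  qed
qed

text \<open>In \<open>eventually_S_near\<close> the pair depends on the radius. A pair minimising
  the distance to \<open>a\<close> up to the slack \<open>1 / (n + 1)\<close> serves all radii at
  once.\<close>

lemma approximating_points:
  assumes a: "a \<in> points X"
  obtains z where "\<And>n. z n \<in> S n" "(\<lambda>n. feature_dist X (fst (z n)) a) \<longlonglongrightarrow> 0"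
proof -
  define I where "I n = (INF p\<in>S n. feature_dist X (fst p) a)" for n
  have bdd: "bdd_below ((\<lambda>p. feature_dist X (fst p) a) ` S n)" for n
    by (rule bdd_belowI[of _ 0]) auto
  have "\<exists>p\<in>S n. feature_dist X (fst p) a < I n + 1 / real (Suc n)" for n
    using S_nonempty[of n] bdd[of n] unfolding I_def by (subst cINF_less_iff[symmetric]) auto
  then obtain z where z: "\<And>n. z n \<in> S n" "\<And>n. feature_dist X (fst (z n)) a < I n + 1 / real (Suc n)"
    by metis
  have "(\<lambda>n. feature_dist X (fst (z n)) a) \<longlonglongrightarrow> 0"
  proof (rule order_tendstoI)
    fix r :: real assume "r < 0"
    then show "eventually (\<lambda>n. r < feature_dist X (fst (z n)) a) sequentially"
      by (intro always_eventually allI) (rule less_le_trans[OF _ X.nonneg])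
  next
    fix r :: real assume r: "0 < r"
    have "eventually (\<lambda>n. 1 / real (Suc n) < r / 2) sequentially"
      using r by real_asymp
    moreover have "eventually (\<lambda>n. \<exists>(x, y)\<in>S n. feature_dist X x a < r / 2) sequentially"
      using r by (intro eventually_S_near[OF a]) simp
    ultimately show "eventually (\<lambda>n. feature_dist X (fst (z n)) a < r) sequentially"
    proof (eventually_elim)
      fix n assume n: "1 / real (Suc n) < r / 2" "\<exists>(x, y)\<in>S n. feature_dist X x a < r / 2"
      then obtain p where "p \<in> S n" "feature_dist X (fst p) a < r / 2"
        by auto
      then have "I n < r / 2"
        unfolding I_def by (intro le_less_trans[OF cINF_lower[OF bdd]])
      then show "feature_dist X (fst (z n)) a < r"
        using z(2)[of n] n(1) by linarith
    qed
  qed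
  with z(1) show ?thesis
    by (rule that)
qed

text \<open>Balls around the partners of points near \<open>a\<close> have mass bounded below, so only boundedly many
  of them are disjoint.\<close>

lemma partners_mtotally_bounded:
  assumes a: "a \<in> points X" and z: "\<And>n. z n \<in> S n"
    and lim: "(\<lambda>n. feature_dist X (fst (z n)) a) \<longlonglongrightarrow> 0"
  shows "Y.mtotally_bounded (range (\<lambda>n. snd (z n)))"
  unfolding Y.mtotally_bounded_def
proof (intro allI impI)
  fix \<epsilon> :: real assume \<epsilon>: "0 < \<epsilon>"
  \<comment> \<open>A point paired with one of the ball lies within
    \<open>r + r + 2 * e n < 4 * r\<close> of \<open>snd (z n)\<close>, and \<open>4 * r\<close> is
    \<epsilon> / 2.\<close>
  define r where "r = \<epsilon> / 8"
  have r: "0 < r"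
    using \<epsilon> by (simp add: r_def)
  \<comment> \<open>Half of the ball's mass remains once \<open>e n\<close> has dropped below the
    other half.\<close>
  define c where "c = measure (law X) (X.mball a r) / 2"
  have c: "0 < c"
    using X.measure_mball_pos[OF a r] by (simp add: c_def)
  have z_pts: "fst (z n) \<in> points X" "snd (z n) \<in> points Y" for n
    using S_points[of "fst (z n)" "snd (z n)" n] z[of n] by auto
  have "eventually (\<lambda>n. c \<le> measure (law Y) (Y.mball (snd (z n)) (\<epsilon> / 2))) sequentially"
    using e_eventually_less[OF r] e_eventually_less[OF c] order_tendstoD(2)[OF lim r]
  proof eventually_elim
    fix n assume n: "e n < r" "e n < c" "feature_dist X (fst (z n)) a < r"
    have "measure (law X) (X.mball a r) \<le> measure (law Y) (Y.mball (snd (z n)) (\<epsilon> / 2)) + e n"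
    proof (rule S_mass_le)
      fix x y assume xy: "(x, y) \<in> S n" "x \<in> X.mball a r"
      have "feature_dist X (fst (z n)) x \<le> feature_dist X (fst (z n)) a + feature_dist X a x"
        using xy a z_pts by (intro X.triangle) auto
      moreover have "feature_dist Y (snd (z n)) y \<le> feature_dist X (fst (z n)) x + 2 * e n"
        using S_dist[of "fst (z n)" "snd (z n)" n x y] z[of n] xy(1) by simp
      ultimately have "feature_dist Y (snd (z n)) y < \<epsilon> / 2"
        using n xy(2) by (simp add: r_def)
      then show "y \<in> Y.mball (snd (z n)) (\<epsilon> / 2)"
        using z_pts S_points[OF xy(1)] by simp
    qed auto
    then show "c \<le> measure (law Y) (Y.mball (snd (z n)) (\<epsilon> / 2))"
      using n(2) by (simp add: c_def)
  qed
  then obtain N where N: "\<And>n. N \<le> n \<Longrightarrow> c \<le> measure (law Y) (Y.mball (snd (z n)) (\<epsilon> / 2))"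
    unfolding eventually_sequentially by auto
  obtain K where K: "finite K" "K \<subseteq> (\<lambda>n. snd (z n)) ` {N..}"
    "(\<lambda>n. snd (z n)) ` {N..} \<subseteq> (\<Union>x\<in>K. Y.mball x \<epsilon>)"
  proof (rule Y.finite_net_of_mass[OF _ c])
    show "(\<lambda>n. snd (z n)) ` {N..} \<subseteq> points Y"
      using z_pts(2) by auto
    show "c \<le> measure (law Y) (Y.mball t (\<epsilon> / 2))" if "t \<in> (\<lambda>n. snd (z n)) ` {N..}" for t
      using that N by auto
  qed (rule that)
  \<comment> \<open>The mass bound holds only from \<open>N\<close> on; the finitely many earlier
    partners join the net as their own centres.\<close>
  let ?K = "K \<union> (\<lambda>n. snd (z n)) ` {..<N}"
  have "snd (z n) \<in> (\<Union>x\<in>?K. Y.mball x \<epsilon>)" for n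
  proof (cases "n < N")
    case True
    then have "snd (z n) \<in> ?K"
      by blast
    then show ?thesis
      by (rule UN_I) (simp only: Y.centre_in_mball_iff z_pts(2) \<epsilon> simp_thms)
  next
    case False
    then have "snd (z n) \<in> (\<Union>x\<in>K. Y.mball x \<epsilon>)"
      by (intro subsetD[OF K(3)] imageI) simp
    then show ?thesis
      by blast
  qed
  then have "range (\<lambda>n. snd (z n)) \<subseteq> (\<Union>x\<in>?K. Y.mball x \<epsilon>)"
    by (intro subsetI) (elim rangeE, simp only:)
  then show "\<exists>K. finite K \<and> K \<subseteq> range (\<lambda>n. snd (z n)) \<and>
      range (\<lambda>n. snd (z n)) \<subseteq> (\<Union>x\<in>K. Y.mball x \<epsilon>)"
    using K(1,2) by (intro exI[of _ ?K]) auto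
qed

text \<open>The pairs \<open>z k n\<close> are fixed before any extraction. For each
  \<open>k\<close> total boundedness yields a Cauchy subsequence of the partners and completeness of
  \<open>Y\<close> its limit; the diagonal handles all \<open>k\<close> simultaneously.\<close>

lemma diagonal_limits:
  fixes s :: "nat \<Rightarrow> 'a"
  assumes s: "\<And>k. s k \<in> points X"
  obtains r :: "nat \<Rightarrow> nat" and y z where "strict_mono r" "\<And>k. y k \<in> points Y" "\<And>k n. z k n \<in> S n"
    "\<And>k. (\<lambda>n. feature_dist X (fst (z k (r n))) (s k)) \<longlonglongrightarrow> 0"
    "\<And>k. (\<lambda>n. feature_dist Y (snd (z k (r n))) (y k)) \<longlonglongrightarrow> 0"
proof -
  have "\<exists>z. (\<forall>n. z n \<in> S n) \<and> (\<lambda>n. feature_dist X (fst (z n)) (s k)) \<longlonglongrightarrow> 0" for k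
    using approximating_points[OF s, of k] by metis
  then obtain z where z: "\<And>k n. z k n \<in> S n"
    "\<And>k. (\<lambda>n. feature_dist X (fst (z k n)) (s k)) \<longlonglongrightarrow> 0"
    by metis
  define P where "P k r \<longleftrightarrow> (\<exists>y\<in>points Y. (\<lambda>n. feature_dist Y (snd (z k (r n))) y) \<longlonglongrightarrow> 0)"
    for k :: nat and r :: "nat \<Rightarrow> nat"
  interpret subseqs P
  proof
    fix k and r :: "nat \<Rightarrow> nat" assume "strict_mono r"
    have "range (\<lambda>n. snd (z k (r n))) \<subseteq> range (\<lambda>n. snd (z k n))"
      by auto
    then obtain r' where r': "strict_mono r'" "Y.MCauchy ((\<lambda>n. snd (z k (r n))) \<circ> r')"
      using partners_mtotally_bounded[OF s z(1) z(2), of k]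
      unfolding Y.mtotally_bounded_sequentially by meson
    then obtain y where "limitin Y.mtopology ((\<lambda>n. snd (z k (r n))) \<circ> r') y sequentially"
      using Y.complete unfolding Y.mcomplete_def by meson
    then have "y \<in> points Y" "(\<lambda>n. feature_dist Y (snd (z k (r (r' n)))) y) \<longlonglongrightarrow> 0"
      by (simp_all add: Y.limitin_metric_dist_null comp_def)
    then show "\<exists>r'. strict_mono r' \<and> P k (r \<circ> r')"
      using r'(1) by (auto simp: P_def)
  qed
  have stable: "P k (r \<circ> r')" if "strict_mono r'" "P k r" for k r r'
    using that LIMSEQ_subseq_LIMSEQ[OF _ that(1)] by (fastforce simp: P_def comp_def)
  \<comment> \<open>The diagonal is a subsequence of the \<open>k\<close>-th extraction only after
    its first \<open>Suc k\<close> terms; limits ignore this shift.\<close>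
  have "P k (diagseq \<circ> (+) (Suc k))" for k
    by (rule diagseq_holds) (rule stable)
  then have "\<exists>y\<in>points Y. (\<lambda>n. feature_dist Y (snd (z k (diagseq n))) y) \<longlonglongrightarrow> 0" for k
    unfolding P_def comp_def using LIMSEQ_offset[where k = "Suc k"] by (fastforce simp: add.commute)
  then obtain y where y: "\<And>k. y k \<in> points Y"
    "\<And>k. (\<lambda>n. feature_dist Y (snd (z k (diagseq n))) (y k)) \<longlonglongrightarrow> 0"
    by metis
  show ?thesis
  proof (rule that[OF subseq_diagseq y(1) z(1) _ y(2)])
    show "(\<lambda>n. feature_dist X (fst (z k (diagseq n))) (s k)) \<longlonglongrightarrow> 0" for k
      using LIMSEQ_subseq_LIMSEQ[OF z(2) subseq_diagseq] by (simp add: comp_def)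
  qed
qed


text \<open>The limits \<open>y k\<close> of the partners of a dense sequence \<open>s k\<close> define a 1-Lipschitz map on the
  sequence; the map of the lemma is its extension by completeness.\<close>

lemma limit_map:
  obtains r :: "nat \<Rightarrow> nat" and \<phi> where "strict_mono r" "\<phi> \<in> points X \<rightarrow> points Y"
    "\<And>a \<epsilon>. a \<in> points X \<Longrightarrow> 0 < \<epsilon> \<Longrightarrow> eventually (\<lambda>n. \<exists>(x, y)\<in>S (r n).
       feature_dist X a x < \<epsilon> \<and> feature_dist Y (\<phi> a) y < \<epsilon>) sequentially"
proof -
  obtain s :: "nat \<Rightarrow> 'a" where s: "\<And>k. s k \<in> points X"
    "\<And>x r. x \<in> points X \<Longrightarrow> 0 < r \<Longrightarrow> \<exists>k. feature_dist X (s k) x < r"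
    by (rule X.dense_sequence) (rule that)
  obtain r y z where r: "strict_mono r" and y: "\<And>k. y k \<in> points Y" and z: "\<And>k n. z k n \<in> S n"
    and x_lim: "\<And>k. (\<lambda>n. feature_dist X (fst (z k (r n))) (s k)) \<longlonglongrightarrow> 0"
    and y_lim: "\<And>k. (\<lambda>n. feature_dist Y (snd (z k (r n))) (y k)) \<longlonglongrightarrow> 0"
    using diagonal_limits[of s] s(1) by metis
  have z_pts: "fst (z k n) \<in> points X" "snd (z k n) \<in> points Y" for k n
    using S_points[of "fst (z k n)" "snd (z k n)" n] z[of k n] by auto
  \<comment> \<open>Distances between partners exceed those of the first coordinates by at most
    \<open>2 * e\<close>, and this excess vanishes in the limit.\<close>
  have y_dist: "feature_dist Y (y k) (y l) \<le> feature_dist X (s k) (s l)" for k l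
  proof (rule LIMSEQ_le_const)
    let ?x = "\<lambda>k n. feature_dist X (fst (z k (r n))) (s k)"
    let ?y = "\<lambda>k n. feature_dist Y (snd (z k (r n))) (y k)"
    have "(\<lambda>n. feature_dist X (s k) (s l) + ?x k n + ?x l n + ?y k n + ?y l n + 2 * e (r n))
        \<longlonglongrightarrow> feature_dist X (s k) (s l) + 0 + 0 + 0 + 0 + 2 * 0"
      using LIMSEQ_subseq_LIMSEQ[OF e_lim r, unfolded comp_def]
      by (intro tendsto_add tendsto_mult tendsto_const x_lim y_lim)
    then show "(\<lambda>n. feature_dist X (s k) (s l) + ?x k n + ?x l n + ?y k n + ?y l n + 2 * e (r n))
        \<longlonglongrightarrow> feature_dist X (s k) (s l)"
      by simp
    have "feature_dist Y (y k) (y l)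
        \<le> feature_dist X (s k) (s l) + ?x k n + ?x l n + ?y k n + ?y l n + 2 * e (r n)" for n
    proof -
      let ?p = "z k (r n)" and ?q = "z l (r n)"
      have "feature_dist Y (y k) (y l) \<le> feature_dist Y (snd ?p) (y k) + feature_dist Y (snd ?p) (y l)"
        "feature_dist Y (snd ?p) (y l) \<le> feature_dist Y (snd ?p) (snd ?q) + feature_dist Y (snd ?q) (y l)"
        using Y.triangle''[OF y z_pts(2) y] Y.triangle[OF z_pts(2) z_pts(2) y] by auto
      moreover have "feature_dist Y (snd ?p) (snd ?q) \<le> feature_dist X (fst ?p) (fst ?q) + 2 * e (r n)"
        using S_dist[of "fst ?p" "snd ?p" "r n" "fst ?q" "snd ?q"] z by simp
      moreover have "feature_dist X (fst ?p) (fst ?q) \<le> feature_dist X (fst ?p) (s l) + feature_dist X (fst ?q) (s l)"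
        "feature_dist X (fst ?p) (s l) \<le> feature_dist X (fst ?p) (s k) + feature_dist X (s k) (s l)"
        using X.triangle'[OF z_pts(1) s(1) z_pts(1)] X.triangle[OF z_pts(1) s(1) s(1)] by auto
      ultimately show ?thesis
        by linarith
    qed
    then show "\<exists>N. \<forall>n\<ge>N. feature_dist Y (y k) (y l)
        \<le> feature_dist X (s k) (s l) + ?x k n + ?x l n + ?y k n + ?y l n + 2 * e (r n)"
      by blast
  qed
  \<comment> \<open>\<open>y k\<close> approximates the value at \<open>a\<close> to within
    \<epsilon> when \<open>s k\<close> is that close to \<open>a\<close>; by \<open>y_dist\<close>
    such approximations are mutually consistent.\<close>
  have "\<exists>b\<in>points Y. \<forall>k \<epsilon>. feature_dist X (s k) a < \<epsilon> \<longrightarrow> feature_dist Y b (y k) \<le> \<epsilon>"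
    if a: "a \<in> points X" for a
  proof (rule Y.mcomplete_approximation[OF Y.complete,
        where P = "\<lambda>\<epsilon> b. \<exists>k. b = y k \<and> feature_dist X (s k) a < \<epsilon>"])
    fix \<epsilon> :: real assume "0 < \<epsilon>"
    then show "\<exists>b\<in>points Y. \<exists>k. b = y k \<and> feature_dist X (s k) a < \<epsilon>"
      using s(2)[OF a] y by blast
  next
    fix \<epsilon> \<epsilon>' b b'
    assume "\<exists>k. b = y k \<and> feature_dist X (s k) a < \<epsilon>" "\<exists>k. b' = y k \<and> feature_dist X (s k) a < \<epsilon>'"
    then obtain k k' where k: "b = y k" "feature_dist X (s k) a < \<epsilon>"
        "b' = y k'" "feature_dist X (s k') a < \<epsilon>'"
      by blast
    have "feature_dist X (s k) (s k') \<le> feature_dist X (s k) a + feature_dist X (s k') a"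
      using s(1) a by (intro X.triangle') auto
    then show "feature_dist Y b b' \<le> \<epsilon> + \<epsilon>'"
      unfolding k(1,3) using y_dist[of k k'] k(2,4) by linarith
  next
    fix l assume "l \<in> points Y"
      and "\<And>\<epsilon> b. b \<in> points Y \<Longrightarrow> \<exists>k. b = y k \<and> feature_dist X (s k) a < \<epsilon> \<Longrightarrow> feature_dist Y l b \<le> \<epsilon>"
    then show "\<exists>b\<in>points Y. \<forall>k \<epsilon>. feature_dist X (s k) a < \<epsilon> \<longrightarrow> feature_dist Y b (y k) \<le> \<epsilon>"
      using y by blast
  qed
  then obtain \<phi> where \<phi>: "\<And>a. a \<in> points X \<Longrightarrow> \<phi> a \<in> points Y"
    "\<And>a k \<epsilon>. a \<in> points X \<Longrightarrow> feature_dist X (s k) a < \<epsilon> \<Longrightarrow> feature_dist Y (\<phi> a) (y k) \<le> \<epsilon>"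
    by metis
  show ?thesis
  proof (rule that[OF r])
    show "\<phi> \<in> points X \<rightarrow> points Y"
      using \<phi>(1) by blast
    fix a and \<epsilon> :: real assume a: "a \<in> points X" and \<epsilon>: "0 < \<epsilon>"
    obtain k where k: "feature_dist X (s k) a < \<epsilon> / 2"
      using s(2)[OF a, of "\<epsilon> / 2"] \<epsilon> by auto
    have half: "0 < \<epsilon> / 2"
      using \<epsilon> by simp
    show "eventually (\<lambda>n. \<exists>(x, y)\<in>S (r n). feature_dist X a x < \<epsilon> \<and> feature_dist Y (\<phi> a) y < \<epsilon>) sequentially"
      using order_tendstoD(2)[OF x_lim[of k] half] order_tendstoD(2)[OF y_lim[of k] half]
    proof eventually_elim
      fix n assume n: "feature_dist X (fst (z k (r n))) (s k) < \<epsilon> / 2"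
        "feature_dist Y (snd (z k (r n))) (y k) < \<epsilon> / 2"
      have "feature_dist X a (fst (z k (r n))) \<le> feature_dist X (s k) a + feature_dist X (fst (z k (r n))) (s k)"
        using X.triangle''[OF a s(1)[of k] z_pts(1)[of k "r n"]]
          X.commute[of "fst (z k (r n))" "s k"] by simp
      moreover have "feature_dist Y (\<phi> a) (snd (z k (r n)))
          \<le> feature_dist Y (\<phi> a) (y k) + feature_dist Y (snd (z k (r n))) (y k)"
        using \<phi>(1)[OF a] y z_pts(2) by (intro Y.triangle') auto
      ultimately show "\<exists>(x, y)\<in>S (r n). feature_dist X a x < \<epsilon> \<and> feature_dist Y (\<phi> a) y < \<epsilon>"
        using n k \<phi>(2)[OF a k] by (intro bexI[OF _ z[of k "r n"]]) (auto simp: case_prod_beta)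
    qed
  qed
qed

text \<open>Each graph point (a, \<phi> a) is a limit of points of \<open>S (r n)\<close>, which
  transfers the matching of features to finite parts of the graph. For the laws an inequality on
  closed sets is enough: a point paired with a point of \<open>C\<close> is, up to small mass, sent
  near \<open>C\<close>.\<close>

lemma exists_isomorphism: "\<exists>\<phi>. data_isomorphism X Y \<phi>"
proof -
  obtain r \<phi> where r: "strict_mono r" and \<phi>: "\<phi> \<in> points X \<rightarrow> points Y"
    and near: "\<And>a \<epsilon>. a \<in> points X \<Longrightarrow> 0 < \<epsilon> \<Longrightarrow> eventually (\<lambda>n. \<exists>(x, y)\<in>S (r n).
       feature_dist X a x < \<epsilon> \<and> feature_dist Y (\<phi> a) y < \<epsilon>) sequentially"
    by (rule limit_map) (rule that)
  have \<phi>_pts: "\<phi> a \<in> points Y" if "a \<in> points X" for a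
    using \<phi> that by auto
  have er_less: "eventually (\<lambda>n. e (r n) < c) sequentially" if "0 < c" for c
    using LIMSEQ_subseq_LIMSEQ[OF e_lim r, unfolded comp_def] that by (rule order_tendstoD)
  have all_near: "eventually (\<lambda>n. \<forall>a\<in>A. \<exists>(x, y)\<in>S (r n).
      feature_dist X a x < \<epsilon> \<and> feature_dist Y (\<phi> a) y < \<epsilon>) sequentially"
    if "finite A" "A \<subseteq> points X" "0 < \<epsilon>" for A \<epsilon>
    using that near by (intro eventually_ball_finite) auto
  have matching: "feature_matching X Y \<phi>"
    unfolding feature_matching_def
  proof (intro allI impI)
    fix A and \<epsilon> :: real assume A: "finite A \<and> A \<subseteq> points X \<and> 0 < \<epsilon>"
    then have \<epsilon>: "0 < \<epsilon> / 3" and A': "finite A" "A \<subseteq> points X"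
      by simp_all
    have "eventually (\<lambda>n. features_close X Y ((\<lambda>a. (a, \<phi> a)) ` A) \<epsilon>) sequentially"
      using all_near[OF A' \<epsilon>] er_less[OF \<epsilon>]
    proof eventually_elim
      fix n assume n: "\<forall>a\<in>A. \<exists>(x, y)\<in>S (r n). feature_dist X a x < \<epsilon> / 3 \<and> feature_dist Y (\<phi> a) y < \<epsilon> / 3"
        "e (r n) < \<epsilon> / 3"
      have "features_close X Y ((\<lambda>a. (a, \<phi> a)) ` A) (e (r n) + 2 * (\<epsilon> / 3))"
        using n(1) A \<phi>_pts
        by (intro features_close_perturb[OF close closedin_subset_points[OF closed]])
          (fastforce intro: less_imp_le)+
      then show "features_close X Y ((\<lambda>a. (a, \<phi> a)) ` A) \<epsilon>"
        by (rule features_close_mono) (use n(2) in auto)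
    qed
    \<comment> \<open>The statement does not depend on \<open>n\<close>, so holding eventually means
      holding.\<close>
    then show "features_close X Y ((\<lambda>a. (a, \<phi> a)) ` A) \<epsilon>"
      by (simp add: eventually_const)
  qed
  note iso = feature_matching_isometry[OF matching \<phi>]
  have meas: "\<phi> \<in> measurable (law X) (law Y)"
    by (rule isometry_measurable[OF \<phi> iso])
  have closed_le: "measure (law Y) C \<le> measure (distr (law X) (law Y) \<phi>) C"
    if C: "closedin Y.mtopology C" for C
  proof -
    let ?\<nu> = "distr (law X) (law Y) \<phi>"
    let ?U = "\<lambda>m. \<Union>c\<in>C. Y.mball c (1 / real (Suc m))"
    interpret \<nu>: prob_space ?\<nu>
      by (rule X.law.prob_space_distr[OF meas])
    have C_sets: "C \<in> sets (law Y)" and C_pts: "C \<subseteq> points Y"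
      using closedin_sets[OF Y.sets_law, of C] closedin_subset[OF C] C
      by (simp_all add: Y.data_topology_eq)
    have bound: "measure (law Y) C \<le> measure ?\<nu> (?U m) + 2 * (1 / real (Suc m))" for m
    proof -
      \<comment> \<open>The chain from \<open>y\<close> over \<open>y'\<close> and the image of the
        centre to the image of \<open>x\<close> is shorter than five times \<epsilon>, hence than
        \<open>1 / real (Suc m)\<close>.\<close>
      define \<epsilon> where "\<epsilon> = 1 / real (Suc m) / 6"
      have \<epsilon>: "0 < \<epsilon>" "0 < \<epsilon> / 2" "1 / real (Suc m) = 6 * \<epsilon>"
        by (simp_all add: \<epsilon>_def del: of_nat_Suc)
      have "openin Y.mtopology (?U m)"
        by (intro openin_Union) auto
      then have U_sets: "?U m \<in> sets (law Y)"
        using openin_sets[OF Y.sets_law] by (simp add: Y.data_topology_eq)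
      obtain s :: "nat \<Rightarrow> 'a" where s: "\<And>k. s k \<in> points X"
        "\<And>x r. x \<in> points X \<Longrightarrow> 0 < r \<Longrightarrow> \<exists>k. feature_dist X (s k) x < r"
        by (rule X.dense_sequence) (rule that)
      obtain N :: nat where N: "1 - \<epsilon> < measure (law X) (\<Union>k<N. X.mball (s k) \<epsilon>)"
        using X.finite_balls_large_mass[OF s \<epsilon>(1) \<epsilon>(1)] by metis
      let ?K = "\<Union>k<N. X.mball (s k) \<epsilon>"
      have "eventually (\<lambda>n. (\<forall>a\<in>s ` {..<N}. \<exists>(x, y)\<in>S (r n). feature_dist X a x < \<epsilon> \<and>
          feature_dist Y (\<phi> a) y < \<epsilon>) \<and> e (r n) < \<epsilon> / 2) sequentially"
        using s(1) \<epsilon> by (intro eventually_conj all_near er_less) auto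
      then obtain n where n: "\<And>k. k < N \<Longrightarrow> \<exists>(x, y)\<in>S (r n). feature_dist X (s k) x < \<epsilon> \<and>
          feature_dist Y (\<phi> (s k)) y < \<epsilon>" and e_n: "e (r n) < \<epsilon> / 2"
        unfolding eventually_sequentially by blast
      let ?V = "\<phi> -` ?U m \<inter> space (law X)"
      have V_sets: "?V \<in> sets (law X)"
        by (rule measurable_sets[OF meas U_sets])
      \<comment> \<open>If the image of \<open>x\<close> avoids the neighbourhood of
        \<open>C\<close>, then no partner of \<open>x\<close> lies in \<open>C\<close>; so
        \<open>?K - ?V\<close> is transported into the complement of \<open>C\<close>.\<close>
      have "measure (law X) (?K - ?V) \<le> measure (law Y) (points Y - C) + e (r n)"
      proof (rule S_mass_le)
        show "?K - ?V \<in> sets (law X)"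
          using V_sets by auto
        show "points Y - C \<in> sets (law Y)"
          using C_sets sets.compl_sets by fastforce
        fix x y assume xy: "(x, y) \<in> S (r n)" and x: "x \<in> ?K - ?V"
        then obtain k where k: "k < N" "feature_dist X (s k) x < \<epsilon>" "x \<in> points X"
          by auto
        obtain x' y' where x'y': "(x', y') \<in> S (r n)" "feature_dist X (s k) x' < \<epsilon>"
          "feature_dist Y (\<phi> (s k)) y' < \<epsilon>"
          using n[OF k(1)] by auto
        have pts: "x' \<in> points X" "y' \<in> points Y" "y \<in> points Y"
          using S_points xy x'y'(1) by auto
        have "y \<notin> C"
        proof
          assume "y \<in> C"
          have "feature_dist X x x' \<le> feature_dist X (s k) x + feature_dist X (s k) x'"
            using k(3) s(1) pts by (intro X.triangle'') auto
          moreover have "feature_dist Y y y' \<le> feature_dist X x x' + 2 * e (r n)"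
            by (rule S_dist[OF xy x'y'(1)])
          moreover have "feature_dist Y (\<phi> (s k)) (\<phi> x) = feature_dist X (s k) x"
            by (rule iso[OF s(1) k(3)])
          moreover have "feature_dist Y y (\<phi> (s k)) \<le> feature_dist Y y y' + feature_dist Y (\<phi> (s k)) y'"
            using pts \<phi>_pts[OF s(1)] by (intro Y.triangle') auto
          moreover have "feature_dist Y y (\<phi> x) \<le> feature_dist Y y (\<phi> (s k)) + feature_dist Y (\<phi> (s k)) (\<phi> x)"
            using pts \<phi>_pts s(1) k(3) by (intro Y.triangle) auto
          ultimately have "feature_dist Y y (\<phi> x) < 1 / real (Suc m)"
            using k(2) x'y'(2,3) e_n \<epsilon> by linarith
          then have "x \<in> ?V"
            using \<open>y \<in> C\<close> k(3) pts \<phi>_pts by auto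
          then show False
            using x by simp
        qed
        then show "y \<in> points Y - C"
          using pts by simp
      qed
      moreover have "measure (law Y) (points Y - C) = 1 - measure (law Y) C"
        using Y.law.prob_compl[OF C_sets] by simp
      moreover have "measure (law X) ?K \<le> measure (law X) (?K - ?V) + measure (law X) ?V"
      proof -
        have "measure (law X) ?K \<le> measure (law X) ((?K - ?V) \<union> ?V)"
          using V_sets by (intro X.law.finite_measure_mono) auto
        also have "\<dots> \<le> measure (law X) (?K - ?V) + measure (law X) ?V"
          using V_sets by (intro measure_Un_le) auto
        finally show ?thesis .
      qed
      moreover have "measure ?\<nu> (?U m) = measure (law X) ?V"
        by (rule measure_distr[OF meas U_sets])
      ultimately show ?thesis
        using N e_n \<epsilon> by linarith
    qed
    \<comment> \<open>Letting \<open>m\<close> grow shrinks the neighbourhoods to \<open>C\<close>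
      and removes the error.\<close>
    have "(\<lambda>m. measure ?\<nu> (?U m) + 2 * (1 / real (Suc m))) \<longlonglongrightarrow> measure ?\<nu> C + 2 * 0"
      by (intro tendsto_add tendsto_mult tendsto_const
          Y.Lim_measure_neighbourhoods[OF \<nu>.finite_measure_axioms _ C] LIMSEQ_Suc[OF lim_1_over_n]) simp
    then show ?thesis
      using bound by (intro LIMSEQ_le_const) auto
  qed
  have "law Y = distr (law X) (law Y) \<phi>"
    by (rule Y.prob_eqI_closed_le[OF Y.law.prob_space_axioms X.law.prob_space_distr[OF meas]])
      (use closed_le in auto)
  then have "data_isomorphism X Y \<phi>"
    using meas matching by (simp add: data_isomorphism_def)
  then show ?thesis by blast
qed

end


lemma (in data_pair) box_distance_eq_0_iff:
  "box_distance X Y = 0 \<longleftrightarrow> isomorphic_data_sets X Y"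
proof
  assume "isomorphic_data_sets X Y"
  then show "box_distance X Y = 0"
    using data_isomorphism_box_distance by (auto simp: isomorphic_data_sets_iff)
next
  assume zero: "box_distance X Y = 0"
  \<comment> \<open>The error is \<open>1 / (n + 2)\<close>, not \<open>1 / (n + 1)\<close>, because
    \<open>box_approximation\<close> requires it to be below 1 already at
    \<open>n = 0\<close>.\<close>
  have "\<exists>\<pi> S. \<pi> \<in> couplings X Y \<and> closedin pair_topology S \<and>
      1 - 1 / real (Suc (Suc n)) < measure \<pi> S \<and> features_close X Y S (1 / real (Suc (Suc n)))" for n
  proof -
    define c where "c = 1 / real (Suc (Suc n)) / 2"
    have c: "2 * c = 1 / real (Suc (Suc n))" "0 < c"
      by (simp_all add: c_def del: of_nat_Suc)
    have "box_distance X Y < ennreal (2 * c)"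
      using zero c(2) by simp
    then obtain \<pi> S where "\<pi> \<in> couplings X Y" "closedin pair_topology S" "1 - 2 * c < measure \<pi> S"
      "features_close X Y S c"
      by (rule box_distance_lessD)
    moreover have "features_close X Y S (2 * c)"
      using \<open>features_close X Y S c\<close> by (rule features_close_mono) (use c(2) in auto)
    ultimately show ?thesis
      unfolding c(1) by blast
  qed
  then obtain \<pi> S where "\<And>n. \<pi> n \<in> couplings X Y" "\<And>n. closedin pair_topology (S n)"
    "\<And>n. 1 - 1 / real (Suc (Suc n)) < measure (\<pi> n) (S n)"
    "\<And>n. features_close X Y (S n) (1 / real (Suc (Suc n)))"
    by metis
  then interpret box_approximation X Y \<pi> S "\<lambda>n. 1 / real (Suc (Suc n))"
    by unfold_locales (simp_all, real_asymp)
  show "isomorphic_data_sets X Y"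
    using exists_isomorphism by (simp add: isomorphic_data_sets_iff)
qed

section \<open>Isomorphism classes\<close>

lemma equiv_data_iso_rel: "equiv {X. geometric_data_set X} data_iso_rel"
proof (rule equivI)
  show "data_iso_rel \<subseteq> {X. geometric_data_set X} \<times> {X. geometric_data_set X}"
    by (auto simp: data_iso_rel_def)
  have iff: "isomorphic_data_sets X Y \<longleftrightarrow> (\<exists>\<phi>. data_isomorphism X Y \<phi>)"
    if "geometric_data_set X" "geometric_data_set Y" for X Y :: "'a data_set"
  proof -
    interpret data_pair X Y using that by unfold_locales
    show ?thesis by (rule isomorphic_data_sets_iff)
  qed
  show "refl_on {X :: 'a data_set. geometric_data_set X} data_iso_rel"
    using data_isomorphism_id by (auto simp: refl_on_def data_iso_rel_def iff)
  show "sym (data_iso_rel :: ('a data_set \<times> 'a data_set) set)"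
  proof (rule symI)
    fix X Y :: "'a data_set" assume XY: "(X, Y) \<in> data_iso_rel"
    then interpret data_pair X Y by unfold_locales (auto simp: data_iso_rel_def)
    have "\<exists>\<psi>. data_isomorphism Y X \<psi>" if "data_isomorphism X Y \<phi>" for \<phi>
      using data_isomorphism_inverse[OF that] by blast
    then show "(Y, X) \<in> data_iso_rel"
      using XY by (auto simp: data_iso_rel_def iff)
  qed
  show "trans (data_iso_rel :: ('a data_set \<times> 'a data_set) set)"
    using data_isomorphism_trans by (intro transI) (auto simp: data_iso_rel_def iff, blast)
qed

text \<open>The triangle inequality, with distance 0 between representatives at both ends, gives one
  inequality; symmetry of the relation gives the other.\<close>

lemma box_distance_respects2: "box_distance respects2 data_iso_rel"
proof (rule congruent2I')
  have le: "box_distance X Y \<le> box_distance X' Y'"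
    if "(X, X') \<in> data_iso_rel" "(Y', Y) \<in> data_iso_rel" for X X' Y Y' :: "'a data_set"
  proof -
    have gds: "geometric_data_set X" "geometric_data_set X'" "geometric_data_set Y" "geometric_data_set Y'"
      and iso: "isomorphic_data_sets X X'" "isomorphic_data_sets Y' Y"
      using that by (auto simp: data_iso_rel_def)
    interpret XX': data_pair X X' using gds by unfold_locales
    interpret Y'Y: data_pair Y' Y using gds by unfold_locales
    have "box_distance X Y \<le> box_distance X X' + (box_distance X' Y' + box_distance Y' Y)"
      using box_distance_triangle[OF gds(1,2,3)] box_distance_triangle[OF gds(2,4,3)]
      by (meson add_left_mono order_trans)
    then show ?thesis
      using XX'.box_distance_eq_0_iff Y'Y.box_distance_eq_0_iff iso by simp
  qed
  fix X X' Y Y' :: "'a data_set" assume rel: "(X, X') \<in> data_iso_rel" "(Y, Y') \<in> data_iso_rel"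
  then have "(X', X) \<in> data_iso_rel" "(Y', Y) \<in> data_iso_rel"
    using equiv_data_iso_rel by (auto simp: equiv_def dest: symD)
  then show "box_distance X Y = box_distance X' Y'"
    using le rel by (intro antisym) auto
qed

lemma class_box_distance_eq:
  assumes "geometric_data_set X" "geometric_data_set Y"
  shows "class_box_distance (data_iso_rel `` {X}) (data_iso_rel `` {Y}) = enn2real (box_distance X Y)"
proof -
  have "(\<Union>X'\<in>data_iso_rel `` {X}. \<Union>Y'\<in>data_iso_rel `` {Y}. {box_distance X' Y'}) = {box_distance X Y}"
    using assms box_distance_respects2
    by (intro UN_equiv_class2[OF equiv_data_iso_rel equiv_data_iso_rel])
      (auto simp: congruent2_def)
  then show ?thesis
    using assms by (simp add: class_box_distance_def data_set_classes_def quotientI)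
qed

theorem proposition5p5:
  shows "equiv {X :: 'a data_set. geometric_data_set X} data_iso_rel \<and>
    (box_distance :: 'a data_set \<Rightarrow> 'a data_set \<Rightarrow> ennreal) respects2 data_iso_rel \<and>
    (\<forall>(X :: 'a data_set) (Y :: 'a data_set). geometric_data_set X \<longrightarrow> geometric_data_set Y \<longrightarrow>
       box_distance X Y < \<infinity>) \<and>
    Metric_space (data_set_classes :: 'a data_set set set) class_box_distance"
proof (intro conjI allI impI equiv_data_iso_rel box_distance_respects2)
  have pair: "data_pair X Y" if "geometric_data_set X" "geometric_data_set Y" for X Y :: "'a data_set"
    using that by unfold_locales
  \<comment> \<open>\<open>enn2real\<close> sends infinity to 0. Finiteness ensures that a vanishing
    class distance means a vanishing box distance and that sums are preserved.\<close>
  show finite: "box_distance X Y < \<infinity>" if "geometric_data_set X" "geometric_data_set Y"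
    for X Y :: "'a data_set"
    using data_pair.box_distance_le_1[OF pair[OF that]] le_less_trans[OF _ ennreal_one_less_top] by simp
  have classE: "\<exists>X. geometric_data_set X \<and> C = data_iso_rel `` {X}"
    if "C \<in> data_set_classes" for C :: "'a data_set set"
    using that unfolding data_set_classes_def by (elim quotientE) auto
  show "Metric_space (data_set_classes :: 'a data_set set set) class_box_distance"
  proof
    show "0 \<le> class_box_distance C D" for C D :: "'a data_set set"
      by (simp add: class_box_distance_def)
  next
    fix C D :: "'a data_set set"
    show "class_box_distance C D = class_box_distance D C"
    \<comment> \<open>\<open>Metric_space\<close> wants symmetry on the whole type; off the classes
      both sides are 0 by convention.\<close>
    proof (cases "C \<in> data_set_classes \<and> D \<in> data_set_classes")
      case True
      then obtain X Y where "geometric_data_set X" "C = data_iso_rel `` {X}"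
        "geometric_data_set Y" "D = data_iso_rel `` {Y}"
        using classE by meson
      then show ?thesis
        using data_pair.box_distance_commute[OF pair, of X Y] by (simp add: class_box_distance_eq)
    qed (auto simp: class_box_distance_def)
  next
    fix C D :: "'a data_set set" assume "C \<in> data_set_classes" "D \<in> data_set_classes"
    then obtain X Y where XY: "geometric_data_set X" "C = data_iso_rel `` {X}"
      "geometric_data_set Y" "D = data_iso_rel `` {Y}"
      using classE by meson
    have "class_box_distance C D = 0 \<longleftrightarrow> box_distance X Y = 0"
      using XY finite[of X Y] by (auto simp: class_box_distance_eq enn2real_eq_0_iff)
    also have "\<dots> \<longleftrightarrow> (X, Y) \<in> data_iso_rel"
      using data_pair.box_distance_eq_0_iff[OF pair, of X Y] XY by (simp add: data_iso_rel_def)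
    also have "\<dots> \<longleftrightarrow> C = D"
      using XY eq_equiv_class_iff[OF equiv_data_iso_rel, of X Y] by simp
    finally show "class_box_distance C D = 0 \<longleftrightarrow> C = D" .
  next
    fix C D E :: "'a data_set set"
    assume "C \<in> data_set_classes" "D \<in> data_set_classes" "E \<in> data_set_classes"
    then obtain X Y Z where XYZ: "geometric_data_set X" "C = data_iso_rel `` {X}"
      "geometric_data_set Y" "D = data_iso_rel `` {Y}"
      "geometric_data_set Z" "E = data_iso_rel `` {Z}"
      using classE by meson
    have "enn2real (box_distance X Z) \<le> enn2real (box_distance X Y + box_distance Y Z)"
      using box_distance_triangle[of X Y Z] XYZ finite[of X Y] finite[of Y Z]
      by (intro enn2real_mono) auto
    also have "\<dots> = enn2real (box_distance X Y) + enn2real (box_distance Y Z)"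
      using XYZ finite[of X Y] finite[of Y Z] by (intro enn2real_plus) auto
    finally show "class_box_distance C E \<le> class_box_distance C D + class_box_distance D E"
      using XYZ by (simp add: class_box_distance_eq)
  qed
qed

end
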